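(* Let $X$ be a random variable with values in a set $\mathcal X$ with distribution $\mu$, and let $\mathcal F$ be a class of hypotheses $f:\mathcal X\to[0,1]$. Fix $\delta\in(0,1)$, $n\ge2$ and set $\mathcal M(n)=10\,\mathcal N_\infty(1/n,\mathcal F,2n)$ and $\lambda=\sqrt{18\ln(3\mathcal M(n)/\delta)}$. Fix $f^*\in\mathcal F$. Then with probability at least $1-\delta$ in the draw of $\mathbf X\sim\mu^n$, $$P(SVP_\lambda(\mathbf X),\mu)-P(f^*,\mu)\le\sqrt{\frac{32V(f^*,\mu)\ln(3\mathcal M(n)/\delta)}{n}}+\frac{22\ln(3\mathcal M(n)/\delta)}{n-1}.$$
   Context: $\mathbf X=(X_1,\dots,X_n)\sim\mu^n$ means that $X_1,\dots,X_n$ are i.i.d. with distribution $\mu$. For $f:\mathcal X\to[0,1]$ and $\mathbf x=(x_1,\dots,x_n)\in\mathcal X^n$: $P(f,\mu)=\mathbb E_{X\sim\mu}f(X)$; $V(f,\mu)=\mathbb V_{X\sim\mu}f(X)$ is the variance of $f(X)$; $P_n(f,\mathbf x)=\frac1n\sum_{i=1}^n f(x_i)$; $V_n(f,\mathbf x)=\frac{1}{n(n-1)}\sum_{1\le i<j\le n}(f(x_i)-f(x_j))^2$. Sample variance penalization: for $\lambda\ge0$, $$SVP_\lambda(\mathbf X)=\arg\min_{f\in\mathcal F}\ P_n(f,\mathbf X)+\lambda\sqrt{\frac{V_n(f,\mathbf X)}{n}},$$ i.e. $SVP_\lambda(\mathbf X)\in\mathcal F$ is a hypothesis attaining this minimum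 (implicitly assumed to exist). $P(SVP_\lambda(\mathbf X),\mu)$ is the risk $P(f,\mu)$ evaluated at the (sample-dependent) function $f=SVP_\lambda(\mathbf X)$. Growth function: for $\epsilon>0$ and an integer $m\ge1$, $$\mathcal N_\infty(\epsilon,\mathcal F,m)=\sup_{\mathbf x\in\mathcal X^m}\mathcal N(\epsilon,\mathcal F(\mathbf x),\|\cdot\|_\infty),$$ where $\mathcal F(\mathbf x)=\{(f(x_1),\dots,f(x_m)):f\in\mathcal F\}\subseteq\mathbb R^m$ and, for $A\subseteq\mathbb R^m$, $\mathcal N(\epsilon,A,\|\cdot\|_\infty)$ is the smallest cardinality $|A_0|$ of a set $A_0\subseteq A$ such that $A$ is contained in the union of the $\epsilon$-balls centered at points of $A_0$, in the metric induced by $\|\cdot\|_\infty$. Questions of measurability are ignored: all functions and events involved are assumed measurable (if necessary this is enforced through finiteness assumptions). *)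

theory Defs
  imports "HOL-Probability.Probability" "HOL-Library.Extended_Nat"
begin

text \<open>A sample of size \<open>n\<close> is a function \<open>x\<close> on the index set \<open>{..<n}\<close>; points are
  numbered from 0. The law of an i.i.d. sample is the product measure \<open>sample_law M n\<close>.\<close>

abbreviation sample_law :: "'a measure \<Rightarrow> nat \<Rightarrow> (nat \<Rightarrow> 'a) measure" where
  "sample_law M n \<equiv> PiM {..<n} (\<lambda>_. M)"

definition risk :: "('a \<Rightarrow> real) \<Rightarrow> 'a measure \<Rightarrow> real" where
  "risk f M = prob_space.expectation M f"

definition true_variance :: "('a \<Rightarrow> real) \<Rightarrow> 'a measure \<Rightarrow> real" where
  "true_variance f M = prob_space.variance M f"

definition empirical_risk :: "nat \<Rightarrow> ('a \<Rightarrow> real) \<Rightarrow> (nat \<Rightarrow> 'a) \<Rightarrow> real" where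
  "empirical_risk n f x = 1 / real n * (\<Sum>i<n. f (x i))"

definition sample_variance :: "nat \<Rightarrow> ('a \<Rightarrow> real) \<Rightarrow> (nat \<Rightarrow> 'a) \<Rightarrow> real" where
  "sample_variance n f x =
     1 / (real n * (real n - 1)) * (\<Sum>(i, j) \<in> {(i, j). i < j \<and> j < n}. (f (x i) - f (x j))\<^sup>2)"

definition svp_objective :: "nat \<Rightarrow> real \<Rightarrow> (nat \<Rightarrow> 'a) \<Rightarrow> ('a \<Rightarrow> real) \<Rightarrow> real" where
  "svp_objective n l x f = empirical_risk n f x + l * sqrt (sample_variance n f x / real n)"

text \<open>The minimizer need not be unique, so sample variance penalization is a relation between a
  sample and a hypothesis.\<close>

definition is_SVP :: "('a \<Rightarrow> real) set \<Rightarrow> nat \<Rightarrow> real \<Rightarrow> (nat \<Rightarrow> 'a) \<Rightarrow> ('a \<Rightarrow> real) \<Rightarrow> bool" where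
  "is_SVP F n l x f \<longleftrightarrow> is_arg_min (svp_objective n l x) (\<lambda>g. g \<in> F) f"

text \<open>Vectors in \<open>\<real>\<^sup>m\<close> are functions on \<open>{..<m}\<close>; the maximum is meaningful for \<open>m \<ge> 1\<close> only.\<close>

definition linf_norm :: "nat \<Rightarrow> (nat \<Rightarrow> real) \<Rightarrow> real" where
  "linf_norm m v = Max ((\<lambda>i. \<bar>v i\<bar>) ` {..<m})"

text \<open>Balls are open and centres lie in \<open>A\<close>. The value is \<open>\<infinity>\<close> if there is no finite cover.\<close>

definition covering_number :: "real \<Rightarrow> nat \<Rightarrow> (nat \<Rightarrow> real) set \<Rightarrow> enat" where
  "covering_number e m A =
     (INF C \<in> {C. finite C \<and> C \<subseteq> A \<and> (\<forall>a\<in>A. \<exists>c\<in>C. linf_norm m (\<lambda>i. a i - c i) < e)}.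
        enat (card C))"

definition projections :: "('a \<Rightarrow> real) set \<Rightarrow> nat \<Rightarrow> (nat \<Rightarrow> 'a) \<Rightarrow> (nat \<Rightarrow> real) set" where
  "projections F m x = (\<lambda>f. \<lambda>i\<in>{..<m}. f (x i)) ` F"

definition growth_function :: "real \<Rightarrow> 'a set \<Rightarrow> ('a \<Rightarrow> real) set \<Rightarrow> nat \<Rightarrow> enat" where
  "growth_function e X F m = (SUP x \<in> {..<m} \<rightarrow>\<^sub>E X. covering_number e m (projections F m x))"

text \<open>For \<open>[0,1]\<close>-valued hypotheses the growth function is finite, so \<open>the_enat\<close> in
  \<open>capacity\<close> discards nothing.\<close>

lemma covering_number_unit_cube:
  assumes e: "e > 0" and m: "m \<ge> 1"
    and A: "\<And>a. a \<in> A \<Longrightarrow> a \<in> {..<m} \<rightarrow>\<^sub>E {0..1}"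
  shows "covering_number e m A \<le> enat (card ({..<m} \<rightarrow>\<^sub>E {0..\<lfloor>1 / e\<rfloor>}))"
proof -
  define q where "q a = (\<lambda>i\<in>{..<m}. \<lfloor>a i / e\<rfloor>)" for a :: "nat \<Rightarrow> real"
  define C where "C = (\<lambda>k. SOME a. a \<in> A \<and> q a = k) ` (q ` A)"
  have q_sub: "q ` A \<subseteq> {..<m} \<rightarrow>\<^sub>E {0..\<lfloor>1 / e\<rfloor>}"
  proof
    fix k assume "k \<in> q ` A"
    then obtain a where a: "a \<in> A" "k = q a" by blast
    have "0 \<le> a i \<and> a i \<le> 1" if "i < m" for i
      using A[OF a(1)] that by (auto simp: PiE_iff)
    then show "k \<in> {..<m} \<rightarrow>\<^sub>E {0..\<lfloor>1 / e\<rfloor>}"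
      using e by (simp add: a(2) q_def PiE_iff floor_mono divide_right_mono)
  qed
  have fin: "finite ({..<m} \<rightarrow>\<^sub>E {0..\<lfloor>1 / e\<rfloor>})"
    by (intro finite_PiE) auto
  have finq: "finite (q ` A)"
    using q_sub fin finite_subset by blast
  have sel: "(SOME b. b \<in> A \<and> q b = q a) \<in> A \<and> q (SOME b. b \<in> A \<and> q b = q a) = q a"
    if "a \<in> A" for a
    using that by (intro someI[of "\<lambda>b. b \<in> A \<and> q b = q a" a]) auto
  have "C \<subseteq> A"
    using sel by (auto simp: C_def)
  moreover have "\<exists>c\<in>C. linf_norm m (\<lambda>i. a i - c i) < e" if a: "a \<in> A" for a
  proof
    let ?c = "SOME b. b \<in> A \<and> q b = q a"
    show "?c \<in> C" using a by (auto simp: C_def)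
    have "\<bar>a i - ?c i\<bar> < e" if i: "i < m" for i
    proof -
      have "q ?c i = q a i" using sel[OF a] by simp
      then have "\<lfloor>?c i / e\<rfloor> = \<lfloor>a i / e\<rfloor>" using i by (simp add: q_def)
      then have "\<bar>a i / e - ?c i / e\<bar> < 1" by linarith
      then have "\<bar>(a i - ?c i) / e\<bar> < 1" by (simp add: diff_divide_distrib)
      then show ?thesis using e by (simp add: abs_divide)
    qed
    then show "linf_norm m (\<lambda>i. a i - ?c i) < e"
      unfolding linf_norm_def using m by (subst Max_less_iff) (simp_all add: lessThan_empty_iff)
  qed
  moreover have "finite C" using finq by (simp add: C_def)
  ultimately have "covering_number e m A \<le> enat (card C)"
    unfolding covering_number_def by (intro INF_lower) auto
  also have "card C \<le> card (q ` A)"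
    unfolding C_def using finq by (rule card_image_le)
  then have "enat (card C) \<le> enat (card ({..<m} \<rightarrow>\<^sub>E {0..\<lfloor>1 / e\<rfloor>}))"
    using card_mono[OF fin q_sub] by simp
  finally show ?thesis .
qed

lemma growth_function_finite:
  assumes "e > 0" "m \<ge> 1" "\<And>f x. f \<in> F \<Longrightarrow> x \<in> X \<Longrightarrow> f x \<in> {0..1}"
  shows "growth_function e X F m < \<infinity>"
proof -
  have "growth_function e X F m \<le> enat (card ({..<m} \<rightarrow>\<^sub>E {0..\<lfloor>1 / e\<rfloor>}))"
    unfolding growth_function_def
  proof (rule SUP_least)
    fix x assume x: "x \<in> {..<m} \<rightarrow>\<^sub>E X"
    have "a \<in> {..<m} \<rightarrow>\<^sub>E {0..1}" if "a \<in> projections F m x" for a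
    proof -
      obtain f where f: "f \<in> F" "a = (\<lambda>i\<in>{..<m}. f (x i))"
        using \<open>a \<in> projections F m x\<close> unfolding projections_def by blast
      have "f (x i) \<in> {0..1}" if "i < m" for i
        using that x assms(3)[OF f(1), of "x i"] by (simp add: PiE_iff)
      then show ?thesis by (simp add: f(2) PiE_iff)
    qed
    then show "covering_number e m (projections F m x)
        \<le> enat (card ({..<m} \<rightarrow>\<^sub>E {0..\<lfloor>1 / e\<rfloor>}))"
      using assms(1,2) by (intro covering_number_unit_cube) auto
  qed
  then show ?thesis
    by (rule order.strict_trans1) simp
qed

definition capacity :: "'a set \<Rightarrow> ('a \<Rightarrow> real) set \<Rightarrow> nat \<Rightarrow> real" where
  "capacity X F n = 10 * real (the_enat (growth_function (1 / real n) X F (2 * n)))"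

end

theory Submission
  imports Defs
begin

text \<open>Put \<open>L = ln (3 * M(n) / \<delta>)\<close>; since risks lie in \<open>[0,1]\<close>, only the case
  \<open>22 * L \<le> n - 1\<close> matters. With probability \<open>1 - \<delta>/3\<close> the risk of the selected hypothesis is at
  most its penalized empirical risk plus \<open>12 * L / (n - 1)\<close>. By minimality, that penalized empirical
  risk is at most the one of \<open>f\<^sup>*\<close>, and Bernstein's inequality for \<open>f\<^sup>*\<close> and for
  \<open>(f\<^sup>* - P(f\<^sup>*))\<^sup>2\<close> bounds the latter.

  The first bound is proved by symmetrization along the selection itself, so that no supremum over the
  class has to be measurable. If the bound fails for \<open>f\<close>, then with conditional probability at least
  \<open>3/10\<close> a ghost sample reveals this. Both samples are then swapped entrywise at random; after replacing
  \<open>f\<close> by a member of a \<open>1/n\<close>-cover on the double sample, a sub-Gaussian tail bound controls the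
  difference of the two means, and a second one the difference of the two scatters about the grand mean.
  The latter allows the variance on both samples to be replaced by the one on the first sample.\<close>

subsection \<open>Exponential tail bounds\<close>

text \<open>The logarithmic estimate behind Hoeffding's lemma, taken at the midpoint
  \<open>1 / 2\<close> with \<open>h = 2 * y\<close> and multiplied by \<open>exp (- y)\<close>,
  gives the case \<open>y \<ge> 0\<close>; evenness gives the rest.\<close>

lemma cosh_le_exp_half_square:
  fixes x :: real
  shows "cosh x \<le> exp (x\<^sup>2 / 2)"
proof -
  have *: "cosh y \<le> exp (y\<^sup>2 / 2)" if "y \<ge> 0" for y :: real
  proof -
    have "- (2 * y) * (1 / 2) + ln (1 + 1 / 2 * (exp (2 * y) - 1)) \<le> (2 * y)\<^sup>2 / 8"
      using that by (intro Hoeffdings_lemma_aux) auto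
    then have "ln ((1 + exp (2 * y)) / 2) \<le> y + y\<^sup>2 / 2"
      by (simp add: field_simps power2_eq_square)
    moreover have "(1 + exp (2 * y)) / 2 > 0" by (simp add: add_pos_pos)
    ultimately have "(1 + exp (2 * y)) / 2 \<le> exp (y + y\<^sup>2 / 2)"
      by (metis exp_le_cancel_iff exp_ln)
    then have "exp (- y) * ((1 + exp (2 * y)) / 2) \<le> exp (- y) * exp (y + y\<^sup>2 / 2)"
      by (intro mult_left_mono) auto
    moreover have "exp (- y) * ((1 + exp (2 * y)) / 2) = cosh y"
      by (simp add: cosh_field_def field_simps flip: exp_add)
    ultimately show ?thesis by (simp flip: exp_add)
  qed
  show ?thesis using *[of x] *[of "- x"] by (cases "x \<ge> 0") auto
qed

text \<open>Chernoff bound for a Rademacher sum, phrased by counting the sets \<open>A\<close> of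
  flipped signs. The exponential sum over all \<open>A\<close> factorizes into terms
  \<open>2 * cosh (s * c i)\<close>. If all coefficients vanish, the strict inequality makes the set
  empty.\<close>

lemma card_sign_sum_exceeding:
  fixes c :: "'i \<Rightarrow> real"
  assumes fin: "finite S" and t: "t > 0"
  shows "real (card {A \<in> Pow S. (\<Sum>i\<in>S. if i \<in> A then - c i else c i) > sqrt (2 * t * (\<Sum>i\<in>S. (c i)\<^sup>2))})
    \<le> 2 ^ card S * exp (- t)"
proof (cases "(\<Sum>i\<in>S. (c i)\<^sup>2) = 0")
  case True
  then have "c i = 0" if "i \<in> S" for i
    using that fin by (simp add: sum_nonneg_eq_0_iff)
  then have "(\<Sum>i\<in>S. if i \<in> A then - c i else c i) = 0" for A
    by (intro sum.neutral) auto
  then show ?thesis using True by simp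
next
  case False
  define D where "D = (\<Sum>i\<in>S. (c i)\<^sup>2)"
  have D: "D > 0" using False by (simp add: D_def less_le sum_nonneg)
  define r where "r = sqrt (2 * t * D)"
  \<comment> \<open>The minimizer of \<open>s\<^sup>2 * D / 2 - s * r\<close>; the minimum is
    \<open>- r\<^sup>2 / (2 * D) = - t\<close>.\<close>
  define s where "s = r / D"
  have r: "r\<^sup>2 = 2 * t * D" "r > 0" using D t by (auto simp: r_def)
  have s: "s > 0" using r D by (simp add: s_def)
  define g where "g A = (\<Sum>i\<in>S. if i \<in> A then - c i else c i)" for A
  let ?B = "{A \<in> Pow S. g A > r}"
  have "real (card ?B) * exp (s * r) = (\<Sum>A\<in>?B. exp (s * r))" by simp
  also have "\<dots> \<le> (\<Sum>A\<in>?B. exp (s * g A))"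
    using s by (intro sum_mono) auto
  also have "\<dots> \<le> (\<Sum>A\<in>Pow S. exp (s * g A))"
    using fin by (intro sum_mono2) auto
  also have "\<dots> = (\<Sum>A\<in>Pow S. (\<Prod>i\<in>A. exp (- s * c i)) * (\<Prod>i\<in>S - A. exp (s * c i)))"
  proof (intro sum.cong refl)
    fix A assume A: "A \<in> Pow S"
    have "exp (s * g A) = (\<Prod>i\<in>S. exp (s * (if i \<in> A then - c i else c i)))"
      using fin by (simp add: g_def sum_distrib_left exp_sum)
    also have "\<dots> = (\<Prod>i\<in>A. exp (s * (if i \<in> A then - c i else c i)))
        * (\<Prod>i\<in>S - A. exp (s * (if i \<in> A then - c i else c i)))"
      using A fin by (subst prod.subset_diff[of A S]) (auto simp: mult.commute)
    finally show "exp (s * g A) = (\<Prod>i\<in>A. exp (- s * c i)) * (\<Prod>i\<in>S - A. exp (s * c i))"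
      by simp
  qed
  also have "\<dots> = (\<Prod>i\<in>S. exp (- s * c i) + exp (s * c i))"
    using fin by (simp add: prod_add)
  also have "\<dots> = (\<Prod>i\<in>S. 2 * cosh (s * c i))"
    by (intro prod.cong) (simp_all add: cosh_field_def)
  also have "\<dots> \<le> (\<Prod>i\<in>S. 2 * exp ((s * c i)\<^sup>2 / 2))"
    by (intro prod_mono) (simp add: cosh_le_exp_half_square)
  also have "\<dots> = 2 ^ card S * exp (s\<^sup>2 * D / 2)"
    using fin by (simp add: prod.distrib exp_sum[symmetric] D_def sum_distrib_left power_mult_distrib
        sum_divide_distrib)
  finally have "real (card ?B) \<le> 2 ^ card S * exp (s\<^sup>2 * D / 2) / exp (s * r)"
    by (simp add: pos_le_divide_eq)
  also have "\<dots> = 2 ^ card S * exp (s\<^sup>2 * D / 2 - s * r)" by (simp add: exp_diff)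
  also have "s\<^sup>2 * D / 2 - s * r = - t"
    using D r by (simp add: s_def power2_eq_square field_simps)
  finally show ?thesis by (simp add: g_def r_def D_def)
qed

section \<open>Bernstein's inequality on product spaces\<close>

text \<open>The second-order Maclaurin remainder carries a factor \<open>exp \<xi>\<close> with
  \<open>\<xi> \<le> s\<close>, and \<open>1 - s \<le> exp (- s)\<close> turns it into
  \<open>1 / (1 - s)\<close>.\<close>

lemma exp_le_quadratic:
  fixes x s :: real
  assumes "\<bar>x\<bar> \<le> s" "s < 1"
  shows "exp x \<le> 1 + x + x\<^sup>2 / (2 * (1 - s))"
proof -
  obtain \<xi> where \<xi>: "\<bar>\<xi>\<bar> \<le> \<bar>x\<bar>" "exp x = (\<Sum>m<2. x ^ m / fact m) + exp \<xi> / fact 2 * x ^ 2"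
    using Maclaurin_exp_le[of x 2] by blast
  have "1 - s \<le> exp (- s)" using exp_ge_add_one_self[of "- s"] by simp
  also have "\<dots> \<le> exp (- \<xi>)" using \<xi>(1) assms by simp
  finally have "exp \<xi> \<le> 1 / (1 - s)"
    using assms by (simp add: exp_minus field_simps)
  then have "exp \<xi> / 2 * x\<^sup>2 \<le> 1 / (1 - s) / 2 * x\<^sup>2"
    by (intro mult_right_mono divide_right_mono) simp_all
  then show ?thesis using \<xi>(2) by (simp add: numeral_2_eq_2 mult.commute)
qed

text \<open>Markov's inequality for the exponential of the sum, whose integral factorizes over the
  coordinates. In each factor the linear term integrates to zero and the quadratic one is controlled
  by \<open>v\<close>.\<close>

lemma PiM_sum_mgf_bound:
  fixes Y :: "'a \<Rightarrow> real" and v s r :: real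
  assumes M: "prob_space M" and I: "finite I"
    and [measurable]: "Y \<in> borel_measurable M"
    and bd: "\<And>x. x \<in> space M \<Longrightarrow> \<bar>Y x\<bar> \<le> 1"
    and mean: "(\<integral>x. Y x \<partial>M) = 0" and var: "(\<integral>x. (Y x)\<^sup>2 \<partial>M) \<le> v"
    and s: "0 < s" "s < 1"
  shows "measure (PiM I (\<lambda>_. M)) {x \<in> space (PiM I (\<lambda>_. M)). (\<Sum>i\<in>I. Y (x i)) \<ge> r}
    \<le> exp (card I * s\<^sup>2 * v / (2 * (1 - s)) - s * r)"
proof -
  interpret M: prob_space M by fact
  interpret product_prob_space "\<lambda>_. M" I by unfold_locales
  let ?P = "PiM I (\<lambda>_. M)"
  have int1: "integrable M (\<lambda>x. exp (s * Y x))"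
    by (rule M.integrable_const_bound[of _ "exp s"])
      (use bd s in \<open>auto intro!: AE_I2 simp: abs_le_iff\<close>)
  have int2: "integrable M Y"
    by (rule M.integrable_const_bound[of _ 1]) (use bd in auto)
  have int3: "integrable M (\<lambda>x. (Y x)\<^sup>2)"
    by (rule M.integrable_const_bound[of _ 1]) (use bd in \<open>auto simp: abs_square_le_1\<close>)
  have "(\<integral>x. exp (s * Y x) \<partial>M) \<le> (\<integral>x. 1 + s * Y x + s\<^sup>2 / (2 * (1 - s)) * (Y x)\<^sup>2 \<partial>M)"
  proof (rule integral_mono)
    fix x assume "x \<in> space M"
    then have "\<bar>s * Y x\<bar> \<le> s" using bd s by (simp add: abs_mult mult_left_le)
    then show "exp (s * Y x) \<le> 1 + s * Y x + s\<^sup>2 / (2 * (1 - s)) * (Y x)\<^sup>2"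
      using exp_le_quadratic[of "s * Y x" s] s by (simp add: power_mult_distrib)
  qed (use int1 int2 int3 in auto)
  also have "\<dots> = 1 + s\<^sup>2 / (2 * (1 - s)) * (\<integral>x. (Y x)\<^sup>2 \<partial>M)"
    using int2 int3 mean by (simp add: M.prob_space)
  also have "\<dots> \<le> 1 + s\<^sup>2 / (2 * (1 - s)) * v"
    using var s by (intro add_left_mono mult_left_mono) auto
  also have "\<dots> \<le> exp (s\<^sup>2 / (2 * (1 - s)) * v)" by (rule exp_ge_add_one_self)
  finally have mgf: "(\<integral>x. exp (s * Y x) \<partial>M) \<le> exp (s\<^sup>2 / (2 * (1 - s)) * v)" .
  have Sm: "(\<lambda>x. \<Prod>i\<in>I. exp (s * Y (x i))) = (\<lambda>x. exp (s * (\<Sum>i\<in>I. Y (x i))))"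
    using I by (simp add: exp_sum sum_distrib_left)
  have intP: "integrable ?P (\<lambda>x. exp (s * (\<Sum>i\<in>I. Y (x i))))"
    unfolding Sm[symmetric] using I int1 by (intro product_integrable_prod)
  have "measure ?P {x \<in> space ?P. (\<Sum>i\<in>I. Y (x i)) \<ge> r}
      = measure ?P {x \<in> space ?P. exp (s * (\<Sum>i\<in>I. Y (x i))) \<ge> exp (s * r)}"
    using s by simp
  also have "\<dots> \<le> (\<integral>x. exp (s * (\<Sum>i\<in>I. Y (x i))) \<partial>?P) / exp (s * r)"
    by (rule integral_Markov_inequality_measure[OF intP, of "space ?P"]) auto
  also have "(\<integral>x. exp (s * (\<Sum>i\<in>I. Y (x i))) \<partial>?P) = (\<Prod>i\<in>I. \<integral>x. exp (s * Y x) \<partial>M)"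
    unfolding Sm[symmetric] using I int1 by (intro product_integral_prod)
  also have "\<dots> \<le> (\<Prod>i\<in>I. exp (s\<^sup>2 / (2 * (1 - s)) * v))"
    by (intro prod_mono conjI mgf) simp
  also have "\<dots> = exp (card I * (s\<^sup>2 / (2 * (1 - s)) * v))" by (simp only: exp_of_nat_mult prod_constant)
  finally show ?thesis by (simp add: divide_right_mono exp_diff mult.assoc)
qed

lemma Bernstein_ineq_PiM:
  fixes Y :: "'a \<Rightarrow> real" and v t :: real
  assumes M: "prob_space M" and I: "finite I"
    and Y: "Y \<in> borel_measurable M"
    and bd: "\<And>x. x \<in> space M \<Longrightarrow> \<bar>Y x\<bar> \<le> 1"
    and mean: "(\<integral>x. Y x \<partial>M) = 0" and var: "(\<integral>x. (Y x)\<^sup>2 \<partial>M) \<le> v"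
    and t: "t > 0"
  shows "measure (PiM I (\<lambda>_. M))
      {x \<in> space (PiM I (\<lambda>_. M)). (\<Sum>i\<in>I. Y (x i)) \<ge> sqrt (2 * card I * v * t) + t} \<le> exp (- t)"
    (is "?p \<le> _")
proof -
  define w where "w = card I * v"
  have "0 \<le> (\<integral>x. (Y x)\<^sup>2 \<partial>M)" by simp
  then have "v \<ge> 0" using var by linarith
  then have w0: "w \<ge> 0" by (simp add: w_def)
  have le: "?p \<le> exp (s\<^sup>2 * w / (2 * (1 - s)) - s * (sqrt (2 * w * t) + t))"
    if "0 < s" "s < 1" for s
    using PiM_sum_mgf_bound[OF M I Y bd mean var that, where r = "sqrt (2 * card I * v * t) + t"]
    by (simp add: w_def mult_ac)
  show ?thesis
  proof (cases "w = 0")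
    case True
    \<comment> \<open>With zero variance no single \<open>s\<close> suffices: the exponent is
      \<open>- s * t\<close>, and \<open>- t\<close> is reached only in the limit \<open>s\<close>
      to 1.\<close>
    have "eventually (\<lambda>s. ?p \<le> exp (- s * t)) (at_left 1)"
      using eventually_at_left_real[of 0 1]
    proof (rule eventually_mono)
      fix s :: real assume "s \<in> {0<..<1}"
      then have s: "0 < s" "s < 1" by auto
      show "?p \<le> exp (- s * t)"
        using le[OF s] by (simp only: True) simp
    qed simp
    moreover have "((\<lambda>s. exp (- s * t)) \<longlongrightarrow> exp (- 1 * t)) (at_left (1::real))"
      by (intro tendsto_intros)
    ultimately show ?thesis
      by (intro tendsto_lowerbound[of "\<lambda>s. exp (- s * t)" _ "at_left (1::real)"]) simp_all
  next
    case False
    then have w: "w > 0" using w0 by simp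
    define b where "b = sqrt (2 * t / w)"
    define q where "q = sqrt (2 * w * t)"
    have b: "b > 0" "b\<^sup>2 * w = 2 * t" using w t by (auto simp: b_def)
    have bq: "b * q = 2 * t"
      unfolding b_def q_def using w t by (simp flip: real_sqrt_mult add: power2_eq_square[symmetric])
        (simp add: real_sqrt_mult)
    \<comment> \<open>The minimizer of the exponent over \<open>0 < s < 1\<close>; at the threshold
      \<open>q + t\<close> the minimum is exactly \<open>- t\<close>.\<close>
    define s where "s = b / (1 + b)"
    have s: "0 < s" "s < 1" using b by (auto simp: s_def)
    have s1: "1 - s = 1 / (1 + b)" using b by (simp add: s_def field_simps)
    have "(b / c)\<^sup>2 / (1 / c) = b\<^sup>2 / c" for c :: real
      by (cases "c = 0") (simp_all add: power2_eq_square)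
    then have "s\<^sup>2 / (1 / (1 + b)) = b\<^sup>2 / (1 + b)"
      unfolding s_def .
    then have "s\<^sup>2 / (1 - s) = b\<^sup>2 / (1 + b)"
      by (simp only: s1)
    moreover have "s\<^sup>2 * w / (2 * (1 - s)) = s\<^sup>2 / (1 - s) * w / 2" by simp
    ultimately have "s\<^sup>2 * w / (2 * (1 - s)) = b\<^sup>2 * w / (2 * (1 + b))" by simp
    also have "\<dots> = (2 * t) / (2 * (1 + b))" by (simp only: b(2))
    also have "\<dots> = t / (1 + b)" by (rule mult_divide_mult_cancel_left) simp
    finally have 1: "s\<^sup>2 * w / (2 * (1 - s)) = t / (1 + b)" .
    have "s * (q + t) = (b * q + b * t) / (1 + b)" by (simp add: s_def field_simps)
    then have 2: "s * (q + t) = (2 * t + b * t) / (1 + b)" by (simp add: bq)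
    have "s\<^sup>2 * w / (2 * (1 - s)) - s * (q + t) = - t"
      unfolding 1 2 diff_divide_distrib[symmetric]
      using b by (subst nonzero_divide_eq_eq) (simp_all add: algebra_simps)
    then show ?thesis using le[OF s] by (simp add: q_def)
  qed
qed

section \<open>Second moments and Markov's inequality\<close>

lemma PiM_integral_sum_square:
  fixes Y :: "'a \<Rightarrow> real"
  assumes M: "prob_space M" and I: "finite I"
    and [measurable]: "Y \<in> borel_measurable M"
    and bd: "\<And>x. x \<in> space M \<Longrightarrow> \<bar>Y x\<bar> \<le> 1"
    and mean: "(\<integral>x. Y x \<partial>M) = 0"
  shows "integrable (PiM I (\<lambda>_. M)) (\<lambda>x. (\<Sum>i\<in>I. Y (x i))\<^sup>2)" (is ?A)
    and "(\<integral>x. (\<Sum>i\<in>I. Y (x i))\<^sup>2 \<partial>PiM I (\<lambda>_. M)) = card I * (\<integral>x. (Y x)\<^sup>2 \<partial>M)" (is ?B)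
proof -
  interpret M: prob_space M by fact
  interpret product_prob_space "\<lambda>_. M" I by unfold_locales
  have int1: "integrable M Y"
    by (rule M.integrable_const_bound[of _ 1]) (use bd in auto)
  have int2: "integrable M (\<lambda>x. (Y x)\<^sup>2)"
    by (rule M.integrable_const_bound[of _ 1]) (use bd in \<open>auto simp: abs_square_le_1\<close>)
  \<comment> \<open>Writes \<open>Y (x i) * Y (x j)\<close> as a product over all coordinates
    \<open>k\<close>, so that the integral formula for products covers \<open>i = j\<close> and
    \<open>i \<noteq> j\<close> at once. For \<open>i \<noteq> j\<close> the factor at
    \<open>k = i\<close> integrates to zero.\<close>
  define g where "g i j k = (\<lambda>x. (if k = i then Y x else 1) * (if k = j then Y x else 1))" for i j k :: 'b
  have g: "integrable M (g i j k)" for i j k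
    using int1 int2 by (cases "k = i"; cases "k = j") (auto simp: g_def power2_eq_square)
  have gp: "(\<Prod>k\<in>I. g i j k (x k)) = Y (x i) * Y (x j)" if "i \<in> I" "j \<in> I" for i j x
    using that I by (simp add: g_def prod.distrib)
  have gi: "integral\<^sup>L M (g i j k) = (if k = i \<and> k = j then \<integral>x. (Y x)\<^sup>2 \<partial>M else if k = i \<or> k = j then 0 else 1)"
    for i j k
    using mean by (auto simp: g_def power2_eq_square M.prob_space)
  have intP: "integrable (PiM I (\<lambda>_. M)) (\<lambda>x. Y (x i) * Y (x j))" if "i \<in> I" "j \<in> I" for i j
    using product_integrable_prod[OF I, of "g i j", OF g] gp[OF that] by simp
  have eP: "(\<integral>x. Y (x i) * Y (x j) \<partial>PiM I (\<lambda>_. M)) = (if i = j then \<integral>x. (Y x)\<^sup>2 \<partial>M else 0)"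
    if "i \<in> I" "j \<in> I" for i j
  proof -
    have "(\<integral>x. Y (x i) * Y (x j) \<partial>PiM I (\<lambda>_. M)) = (\<Prod>k\<in>I. integral\<^sup>L M (g i j k))"
      using product_integral_prod[OF I, of "g i j", OF g] gp[OF that] by simp
    also have "\<dots> = (if i = j then \<integral>x. (Y x)\<^sup>2 \<partial>M else 0)"
    proof (cases "i = j")
      case True
      then show ?thesis using I that by (simp add: gi prod.delta cong: if_cong)
    next
      case False
      then show ?thesis using I that by (auto simp: gi intro!: prod_zero bexI[of _ i])
    qed
    finally show ?thesis .
  qed
  have sq: "(\<Sum>i\<in>I. Y (x i))\<^sup>2 = (\<Sum>i\<in>I. \<Sum>j\<in>I. Y (x i) * Y (x j))" for x
    by (simp add: power2_eq_square sum_product)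
  show ?A unfolding sq by (intro Bochner_Integration.integrable_sum intP)
  show ?B unfolding sq using I
    by (simp add: Bochner_Integration.integral_sum intP eP Bochner_Integration.integrable_sum)
qed

text \<open>The event is strict so that the bound survives \<open>e = 0\<close>, where it becomes a
  null set. This matters because \<open>e\<close> will be a multiple of a variance, which may
  vanish.\<close>

lemma Markov_ineq_multiple:
  fixes u :: "'a \<Rightarrow> real"
  assumes int: "integrable M u" and nn: "\<And>x. x \<in> space M \<Longrightarrow> 0 \<le> u x"
    and le: "(\<integral>x. u x \<partial>M) \<le> e" and k: "k > 0"
  shows "measure M {x \<in> space M. u x > k * e} \<le> 1 / k"
proof (cases "e = 0")
  case True
  have "(\<integral>x. u x \<partial>M) \<ge> 0" using nn by (simp add: integral_nonneg_AE)
  then have "(\<integral>x. u x \<partial>M) = 0" using le True by simp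
  moreover have "AE x in M. 0 \<le> u x" using nn by (rule AE_I2)
  ultimately have "AE x in M. u x = 0"
    using integral_nonneg_eq_0_iff_AE[OF int] by blast
  then have "AE x in M. x \<notin> {x \<in> space M. u x > k * e}"
    by eventually_elim (simp add: True)
  then have "measure M {x \<in> space M. u x > k * e} = 0"
    using int by (intro measure_eq_AE[where B = "{}", simplified]) auto
  then show ?thesis using k by simp
next
  case False
  have "(\<integral>x. u x \<partial>M) \<ge> 0" using nn by (simp add: integral_nonneg_AE)
  then have e: "e > 0" using False le by simp
  have fin: "emeasure M {x \<in> space M. u x \<ge> k * e} \<noteq> \<infinity>"
    using integral_Markov_inequality[OF int, of "k * e"] nn k e
    by (auto simp: top_unique)
  have [measurable]: "u \<in> borel_measurable M" using int by auto
  have "measure M {x \<in> space M. u x > k * e} \<le> measure M {x \<in> space M. u x \<ge> k * e}"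
    using fin by (intro measure_mono_fmeasurable) (auto simp: fmeasurable_def less_top)
  also have "\<dots> \<le> (\<integral>x. u x \<partial>M) / (k * e)"
    using nn k e by (intro integral_Markov_inequality_measure[OF int, of "space M"]) auto
  also have "\<dots> \<le> e / (k * e)" using le k e by (intro divide_right_mono) auto
  finally show ?thesis using e by simp
qed

subsection \<open>Empirical variances of two samples\<close>

definition mean :: "nat \<Rightarrow> (nat \<Rightarrow> real) \<Rightarrow> real" where
  "mean n a = (\<Sum>i<n. a i) / real n"

text \<open>Left unnormalized: it is \<open>n - 1\<close> times the sample variance and the squared
  Euclidean norm of the centered vector.\<close>

definition scatter :: "nat \<Rightarrow> (nat \<Rightarrow> real) \<Rightarrow> real" where
  "scatter n a = (\<Sum>i<n. (a i - mean n a)\<^sup>2)"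

lemma scatter_nonneg: "0 \<le> scatter n a"
  by (simp add: scatter_def sum_nonneg)

lemma sum_eq_mean: "(\<Sum>i<n. a i) = real n * mean n a"
  by (cases "n = 0") (simp_all add: mean_def)

text \<open>The parallel axis identity: the cross term vanishes because deviations from the mean sum
  to zero.\<close>

lemma sum_square_diff_const:
  "(\<Sum>i<n. (a i - c)\<^sup>2) = scatter n a + real n * (mean n a - c)\<^sup>2"
proof -
  have "(\<Sum>i<n. (a i - c)\<^sup>2)
      = (\<Sum>i<n. (a i - mean n a)\<^sup>2 + 2 * (mean n a - c) * (a i - mean n a) + (mean n a - c)\<^sup>2)"
    by (intro sum.cong) (auto simp: power2_eq_square algebra_simps)
  also have "\<dots> = scatter n a + 2 * (mean n a - c) * ((\<Sum>i<n. a i) - n * mean n a)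
      + n * (mean n a - c)\<^sup>2"
    by (simp add: sum.distrib scatter_def flip: sum_distrib_left) (simp add: sum_subtractf)
  finally show ?thesis by (simp add: sum_eq_mean)
qed

lemma scatter_le_sum_square: "scatter n a \<le> (\<Sum>i<n. (a i - c)\<^sup>2)"
  by (simp add: sum_square_diff_const)

text \<open>Lagrange's identity for \<open>a\<close> and the constant vector 1. The induction splits
  off the pairs whose larger index is \<open>n\<close>.\<close>

lemma sum_pairs_diff_square:
  fixes a :: "nat \<Rightarrow> real"
  shows "(\<Sum>(i, j) \<in> {(i, j). i < j \<and> j < n}. (a i - a j)\<^sup>2) = n * (\<Sum>i<n. (a i)\<^sup>2) - (\<Sum>i<n. a i)\<^sup>2"
proof (induction n)
  case 0
  then show ?case by simp
next
  case (Suc n)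
  let ?S = "\<lambda>n. {(i, j). i < j \<and> j < n} :: (nat \<times> nat) set"
  have S: "?S (Suc n) = ?S n \<union> (\<lambda>i. (i, n)) ` {..<n}" by (auto simp: less_Suc_eq)
  have "finite (?S n)"
    by (rule finite_subset[of _ "{..<n} \<times> {..<n}"]) auto
  then have "(\<Sum>(i, j) \<in> ?S (Suc n). (a i - a j)\<^sup>2)
      = (\<Sum>(i, j) \<in> ?S n. (a i - a j)\<^sup>2) + (\<Sum>(i, j) \<in> (\<lambda>i. (i, n)) ` {..<n}. (a i - a j)\<^sup>2)"
    unfolding S by (intro sum.union_disjoint) auto
  also have "(\<Sum>(i, j) \<in> (\<lambda>i. (i, n)) ` {..<n}. (a i - a j)\<^sup>2) = (\<Sum>i<n. (a i - a n)\<^sup>2)"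
    by (subst sum.reindex) (auto simp: inj_on_def)
  also have "\<dots> = (\<Sum>i<n. (a i)\<^sup>2 - 2 * a n * a i + (a n)\<^sup>2)"
    by (intro sum.cong) (auto simp: power2_eq_square algebra_simps)
  also have "\<dots> = (\<Sum>i<n. (a i)\<^sup>2) - 2 * a n * (\<Sum>i<n. a i) + n * (a n)\<^sup>2"
    by (simp add: sum.distrib sum_subtractf sum_distrib_left)
  finally show ?case unfolding Suc.IH
    by (simp add: power2_eq_square algebra_simps)
qed

lemma sample_variance_eq:
  "sample_variance n f x = scatter n (\<lambda>i. f (x i)) / (real n - 1)"
proof (cases "n = 0")
  case True
  then show ?thesis by (simp add: sample_variance_def scatter_def)
next
  case False
  let ?a = "\<lambda>i. f (x i)"
  have "(\<Sum>i<n. (?a i)\<^sup>2) = scatter n ?a + n * (mean n ?a)\<^sup>2"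
    using sum_square_diff_const[of ?a 0 n] by simp
  then have "(\<Sum>(i, j) \<in> {(i, j). i < j \<and> j < n}. (f (x i) - f (x j))\<^sup>2) = n * scatter n ?a"
    using sum_pairs_diff_square[where a = ?a and n = n]
    by (simp add: sum_eq_mean power2_eq_square algebra_simps)
  then show ?thesis using False by (simp add: sample_variance_def)
qed

lemma empirical_risk_eq: "empirical_risk n f x = mean n (\<lambda>i. f (x i))"
  by (simp add: empirical_risk_def mean_def)

text \<open>The root of the scatter is a seminorm, and centering does not increase the Euclidean
  norm. This is the price of replacing a hypothesis by a cover element.\<close>

lemma sqrt_scatter_le:
  assumes "\<And>i. i < n \<Longrightarrow> \<bar>a i - b i\<bar> \<le> e" "e \<ge> 0"
  shows "sqrt (scatter n a) \<le> sqrt (scatter n b) + sqrt n * e"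
proof -
  let ?c = "\<lambda>i. a i - b i"
  have "mean n ?c = mean n a - mean n b"
    by (simp add: mean_def sum_subtractf diff_divide_distrib)
  then have eq: "a i - mean n a = (b i - mean n b) + (?c i - mean n ?c)" for i by simp
  have L2: "L2_set (\<lambda>i. a i - mean n a) {..<n} = sqrt (scatter n a)" for a
    by (simp add: L2_set_def scatter_def)
  have "sqrt (scatter n a) = L2_set (\<lambda>i. (b i - mean n b) + (?c i - mean n ?c)) {..<n}"
    unfolding L2[symmetric] eq[symmetric] ..
  also have "\<dots> \<le> sqrt (scatter n b) + sqrt (scatter n ?c)"
    unfolding L2[symmetric] by (rule L2_set_triangle_ineq)
  also have "scatter n ?c \<le> (\<Sum>i<n. (?c i - 0)\<^sup>2)" by (rule scatter_le_sum_square)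
  also have "\<dots> \<le> (\<Sum>i<n. e\<^sup>2)"
    using assms by (intro sum_mono) (auto simp: abs_le_square_iff[symmetric])
  also have "\<dots> = n * e\<^sup>2" by simp
  finally show ?thesis using assms(2) by (simp add: real_sqrt_mult)
qed

lemma mean_le_mean:
  assumes "\<And>i. i < n \<Longrightarrow> a i \<le> b i + e" "n > 0"
  shows "mean n a \<le> mean n b + e"
proof -
  have "(\<Sum>i<n. a i) \<le> (\<Sum>i<n. b i + e)" using assms by (intro sum_mono) auto
  then show ?thesis using assms(2) by (simp add: mean_def field_simps sum.distrib)
qed

text \<open>If \<open>x\<close> exceeded \<open>p + q\<close>, both factors would exceed
  \<open>q\<close>. The lemma solves the self-bounding inequalities below without the quadratic
  formula.\<close>

lemma quadratic_root_bound:
  fixes x p q :: real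
  assumes "x * (x - p) \<le> q\<^sup>2" "p \<ge> 0" "q \<ge> 0"
  shows "x \<le> p + q"
proof (rule ccontr)
  assume "\<not> x \<le> p + q"
  then have "x > q" "x - p > q" using assms by auto
  then have "x * (x - p) > q * q" using assms by (intro mult_strict_mono) auto
  then show False using assms by (simp add: power2_eq_square)
qed

text \<open>The three inequalities hold for all but a fraction \<open>3 * exp (- L)\<close> of the ways to swap
  entries between \<open>v\<close> and \<open>v'\<close>; their right-hand sides and \<open>m\<close> are invariant under swaps.\<close>

definition balanced :: "nat \<Rightarrow> real \<Rightarrow> (nat \<Rightarrow> real) \<Rightarrow> (nat \<Rightarrow> real) \<Rightarrow> bool" where
  "balanced n L v v' \<longleftrightarrow> (let m = (mean n v + mean n v') / 2 in
     (\<Sum>i<n. v' i - v i) \<le> sqrt (2 * L * (\<Sum>i<n. (v' i - v i)\<^sup>2)) \<and>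
     (\<Sum>i<n. v i - v' i) \<le> sqrt (2 * L * (\<Sum>i<n. (v' i - v i)\<^sup>2)) \<and>
     (\<Sum>i<n. (v' i - m)\<^sup>2 - (v i - m)\<^sup>2)
       \<le> sqrt (2 * L * (\<Sum>i<n. ((v' i - m)\<^sup>2 - (v i - m)\<^sup>2)\<^sup>2)))"

section \<open>Deterministic consequences of balance\<close>

text \<open>\<open>\<tau>\<close> is the root of the scatter \<open>T\<close> of all
  \<open>2 * n\<close> values about the grand mean. It dominates both right-hand sides in
  \<open>balanced\<close>, and the third inequality there bounds \<open>T\<close> in terms of the
  first sample and of \<open>\<tau>\<close> itself, which is then solved for
  \<open>\<tau>\<close>.\<close>

lemma balanced_sample_bounds:
  fixes v v' :: "nat \<Rightarrow> real" and L :: real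
  assumes L: "L > 0" "22 * L \<le> real n"
    and v: "\<And>i. i < n \<Longrightarrow> v i \<in> {0..1}" "\<And>i. i < n \<Longrightarrow> v' i \<in> {0..1}"
    and bal: "balanced n L v v'"
  obtains \<tau> where "\<tau> \<ge> 0" "scatter n v' \<le> \<tau>\<^sup>2"
    "real n * (mean n v' - mean n v) \<le> 2 * sqrt L * \<tau>"
    "\<tau> \<le> 15557 / 10000 * sqrt L + 14833 / 10000 * sqrt (scatter n v)"
proof -
  define m where "m = (mean n v + mean n v') / 2"
  have dev: "(\<Sum>i<n. v' i - v i) \<le> sqrt (2 * L * (\<Sum>i<n. (v' i - v i)\<^sup>2))"
      "(\<Sum>i<n. v i - v' i) \<le> sqrt (2 * L * (\<Sum>i<n. (v' i - v i)\<^sup>2))"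
    and scat: "(\<Sum>i<n. (v' i - m)\<^sup>2 - (v i - m)\<^sup>2)
      \<le> sqrt (2 * L * (\<Sum>i<n. ((v' i - m)\<^sup>2 - (v i - m)\<^sup>2)\<^sup>2))"
    using bal unfolding balanced_def Let_def m_def by blast+
  define T where "T = (\<Sum>i<n. (v i - m)\<^sup>2) + (\<Sum>i<n. (v' i - m)\<^sup>2)"
  define d where "d = mean n v' - mean n v"
  define D where "D = (\<Sum>i<n. (v' i - v i)\<^sup>2)"
  define Q where "Q = (\<Sum>i<n. ((v' i - m)\<^sup>2 - (v i - m)\<^sup>2)\<^sup>2)"
  have n: "n > 0" using L by (cases n) auto
  have T0: "T \<ge> 0" by (simp add: T_def sum_nonneg)
  have D0: "D \<ge> 0" by (simp add: D_def sum_nonneg)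
  have nd: "real n * d = (\<Sum>i<n. v' i - v i)" by (simp add: d_def sum_subtractf sum_eq_mean algebra_simps)
  have S: "(\<Sum>i<n. (v i - m)\<^sup>2) = scatter n v + n * (d / 2)\<^sup>2"
    "(\<Sum>i<n. (v' i - m)\<^sup>2) = scatter n v' + n * (d / 2)\<^sup>2"
    unfolding sum_square_diff_const m_def d_def by (simp_all add: power2_eq_square field_simps)
  have DT: "D \<le> 2 * T"
  proof -
    have "D \<le> (\<Sum>i<n. 2 * ((v i - m)\<^sup>2 + (v' i - m)\<^sup>2))"
      unfolding D_def
    proof (intro sum_mono)
      fix i
      have "0 \<le> ((v i - m) + (v' i - m))\<^sup>2" by simp
      then show "(v' i - v i)\<^sup>2 \<le> 2 * ((v i - m)\<^sup>2 + (v' i - m)\<^sup>2)"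
        by (simp add: power2_eq_square algebra_simps)
    qed
    then show ?thesis by (simp add: T_def sum.distrib sum_distrib_left)
  qed
  have m01: "0 \<le> m" "m \<le> 1"
  proof -
    have "mean n v \<le> 1 \<and> 0 \<le> mean n v" "mean n v' \<le> 1 \<and> 0 \<le> mean n v'"
      using v n sum_bounded_above[of "{..<n}" v 1] sum_bounded_above[of "{..<n}" v' 1]
      by (auto simp: mean_def intro!: divide_nonneg_nonneg sum_nonneg)
    then show "0 \<le> m" "m \<le> 1" by (auto simp: m_def)
  qed
  \<comment> \<open>Values and grand mean lie in \<open>[0,1]\<close>, so each difference of squared
    deviations has modulus at most 1 and its square is at most its modulus.\<close>
  have QT: "Q \<le> T"
  proof -
    have "Q \<le> (\<Sum>i<n. (v i - m)\<^sup>2 + (v' i - m)\<^sup>2)"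
      unfolding Q_def
    proof (intro sum_mono)
      fix i assume "i \<in> {..<n}"
      then have "\<bar>v i - m\<bar> \<le> 1" "\<bar>v' i - m\<bar> \<le> 1" using v[of i] m01 by auto
      then have b: "(v i - m)\<^sup>2 \<le> 1" "(v' i - m)\<^sup>2 \<le> 1" by (auto simp: abs_square_le_1)
      have nn: "(v i - m)\<^sup>2 \<ge> 0" "(v' i - m)\<^sup>2 \<ge> 0" by auto
      let ?x = "(v' i - m)\<^sup>2 - (v i - m)\<^sup>2"
      have "?x\<^sup>2 = \<bar>?x\<bar> * \<bar>?x\<bar>" by (simp add: power2_eq_square)
      also have "\<dots> \<le> \<bar>?x\<bar> * 1"
      proof (intro mult_left_mono)
        show "\<bar>?x\<bar> \<le> 1" using b nn by linarith
      qed simp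
      also have "\<dots> = \<bar>?x\<bar>" by simp
      also have "\<bar>?x\<bar> \<le> (v i - m)\<^sup>2 + (v' i - m)\<^sup>2" using nn by linarith
      finally show "?x\<^sup>2 \<le> (v i - m)\<^sup>2 + (v' i - m)\<^sup>2" .
    qed
    then show ?thesis by (simp add: T_def sum.distrib)
  qed
  define \<tau> where "\<tau> = sqrt T"
  have \<tau>: "\<tau> \<ge> 0" "\<tau>\<^sup>2 = T" using T0 by (auto simp: \<tau>_def)
  define w where "w = sqrt (scatter n v)"
  have w: "w \<ge> 0" "w\<^sup>2 = scatter n v" using scatter_nonneg by (auto simp: w_def)
  have "sqrt (2 * L * D) \<le> sqrt (4 * L * T)" using DT L by (intro real_sqrt_le_mono) simp
  also have "\<dots> = 2 * sqrt L * \<tau>" by (simp add: real_sqrt_mult \<tau>_def)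
  finally have d1: "\<bar>real n * d\<bar> \<le> 2 * sqrt L * \<tau>"
    using dev nd unfolding D_def[symmetric] by (auto simp: abs_le_iff sum_subtractf)
  have "(real n * d)\<^sup>2 \<le> (2 * sqrt L * \<tau>)\<^sup>2"
    using d1 L \<tau> by (simp add: abs_le_square_iff[symmetric] abs_mult)
  also have "\<dots> = 4 * L * T" using L \<tau>(2) by (simp add: power_mult_distrib)
  also have "(real n * d)\<^sup>2 = n * (n * d\<^sup>2)" by (simp add: power2_eq_square)
  finally have "n * (n * d\<^sup>2) \<le> 4 * L * T" .
  also have "\<dots> \<le> 4 * (n / 22) * T" using L T0 by (intro mult_right_mono) auto
  finally have "n * (n * d\<^sup>2) \<le> n * (T * (4 / 22))" by (simp add: field_simps)
  then have d2: "n * d\<^sup>2 \<le> T * (4 / 22)" using n by simp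
  have "sqrt (2 * L * Q) \<le> sqrt (2 * L * T)" using QT L by (intro real_sqrt_le_mono) simp
  also have "\<dots> = sqrt 2 * sqrt L * \<tau>" by (simp add: real_sqrt_mult \<tau>_def)
  finally have "scatter n v' - scatter n v \<le> sqrt 2 * sqrt L * \<tau>"
    using scat S unfolding Q_def[symmetric] by (simp add: sum_subtractf)
  moreover have "T = scatter n v + scatter n v' + n * d\<^sup>2 / 2"
    unfolding T_def S by (simp add: power2_eq_square)
  \<comment> \<open>The term \<open>T / 11\<close> is half of the bound on
    \<open>n * d\<^sup>2\<close>, which uses \<open>22 * L \<le> n\<close>. Moving it to the left
    multiplies the rest by \<open>11 / 10\<close>. Below, \<open>14833 / 10000\<close> rounds up the
    root of \<open>11 / 5\<close>, and \<open>15557 / 10000\<close> rounds up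
    \<open>11 / 10 * sqrt 2\<close>.\<close>
  ultimately have "T \<le> 2 * w\<^sup>2 + sqrt 2 * sqrt L * \<tau> + T / 11"
    using d2 unfolding w by linarith
  then have "\<tau> * (\<tau> - 11 / 10 * (sqrt 2 * sqrt L)) \<le> 11 / 5 * w\<^sup>2"
    unfolding \<tau>(2)[symmetric] by (simp add: power2_eq_square algebra_simps)
  also have "\<dots> \<le> (14833 / 10000 * w)\<^sup>2"
    unfolding power_mult_distrib by (intro mult_right_mono) (auto simp: power2_eq_square)
  finally have "\<tau> \<le> 11 / 10 * (sqrt 2 * sqrt L) + 14833 / 10000 * w"
    using L w by (intro quadratic_root_bound) auto
  moreover have "sqrt 2 \<le> 141422 / 100000" by (rule real_le_lsqrt) (auto simp: power2_eq_square)
  then have "sqrt 2 * sqrt L \<le> 141422 / 100000 * sqrt L" using L by (intro mult_right_mono) auto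
  moreover have "sqrt L \<ge> 0" using L by simp
  ultimately have "\<tau> \<le> 15557 / 10000 * sqrt L + 14833 / 10000 * w" by linarith
  moreover have "scatter n v' \<le> \<tau>\<^sup>2"
    unfolding \<tau> T_def using scatter_le_sum_square[of n v' m] by (simp add: sum_nonneg add_increasing)
  ultimately show thesis using that[of \<tau>] \<tau> d1 by (simp add: w_def d_def abs_le_iff)
qed

text \<open>\<open>y\<close> and \<open>y'\<close> are the values of a hypothesis with risk
  \<open>P\<close> and variance \<open>V\<close> on the two samples, \<open>v\<close> and
  \<open>v'\<close> those of a nearby cover element. The ghost conditions tie \<open>P\<close> to
  \<open>mean n y'\<close> and \<open>V\<close> to \<open>scatter n y'\<close>; closeness passes
  from \<open>y'\<close> to \<open>v'\<close>, balance from \<open>v'\<close> to \<open>v\<close>,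
  closeness again to \<open>y\<close>.\<close>

lemma ghost_sample_implies_bound:
  fixes y y' v v' :: "nat \<Rightarrow> real" and L P V :: real
  assumes L: "L \<ge> 3" "22 * L \<le> real n - 1"
    and v: "\<And>i. i < n \<Longrightarrow> v i \<in> {0..1}" "\<And>i. i < n \<Longrightarrow> v' i \<in> {0..1}"
    and near: "\<And>i. i < n \<Longrightarrow> \<bar>y i - v i\<bar> \<le> 1 / n" "\<And>i. i < n \<Longrightarrow> \<bar>y' i - v' i\<bar> \<le> 1 / n"
    and bal: "balanced n L v v'"
    and V: "V \<ge> 0"
    and ghost: "(\<Sum>i<n. y' i - P)\<^sup>2 \<le> 2 * (n * V)" "n * V \<le> (\<Sum>i<n. (y' i - P)\<^sup>2) + sqrt (5 * (n * V))"
  shows "P \<le> mean n y + sqrt (18 * L * (scatter n y / (real n - 1)) / n) + 12 * L / (real n - 1)"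
proof -
  \<comment> \<open>Since \<open>22 * 3 + 1 = 67\<close>. This yields \<open>sqrt n \<ge> 8\<close>,
    so the cover error in root scatter is at most \<open>1 / 8\<close>, and
    \<open>2 * V \<le> 3 / 100 * (n * V)\<close>.\<close>
  have n67: "real n \<ge> 67" using L by linarith
  then have n0: "n > 0" by (cases n) auto
  have "L > 0" "22 * L \<le> real n" using L by auto
  from balanced_sample_bounds[OF this v bal] obtain \<tau> where
    \<tau>: "\<tau> \<ge> 0" "scatter n v' \<le> \<tau>\<^sup>2"
    "real n * (mean n v' - mean n v) \<le> 2 * sqrt L * \<tau>"
    "\<tau> \<le> 15557 / 10000 * sqrt L + 14833 / 10000 * sqrt (scatter n v)" by blast
  define z where "z = sqrt (n * V)"
  have z: "z \<ge> 0" "z\<^sup>2 = n * V" using V by (auto simp: z_def)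
  have "sqrt n * (1 / n) = 1 / sqrt n" using n0 by (simp add: field_simps)
  also have "\<dots> \<le> 1 / 8"
  proof -
    have "8 \<le> sqrt n" using n67 by (intro real_le_rsqrt) auto
    then show ?thesis by (simp add: divide_le_eq)
  qed
  finally have rn: "sqrt n * (1 / n) \<le> 1 / 8" .
  have nP: "(\<Sum>i<n. y' i - P) = n * (mean n y' - P)"
    by (simp add: sum_subtractf sum_eq_mean algebra_simps)
  have "(n * (P - mean n y'))\<^sup>2 \<le> 2 * z\<^sup>2"
    using ghost(1) unfolding nP z by (simp add: power2_commute power_mult_distrib)
  then have "n * (P - mean n y') \<le> sqrt (2 * z\<^sup>2)" by (rule real_le_rsqrt)
  also have "\<dots> = sqrt 2 * z" using z(1) by (simp add: real_sqrt_mult)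
  also have "\<dots> \<le> 141422 / 100000 * z"
    using z by (intro mult_right_mono real_le_lsqrt) (auto simp: power2_eq_square)
  finally have P1: "n * (P - mean n y') \<le> 141422 / 100000 * z" .
  have "(\<Sum>i<n. (y' i - P)\<^sup>2) = scatter n y' + n * (mean n y' - P)\<^sup>2"
    by (rule sum_square_diff_const)
  moreover have "n * (n * (mean n y' - P)\<^sup>2) \<le> n * (2 * V)"
    using ghost(1) unfolding nP by (simp add: power2_eq_square mult_ac)
  then have "n * (mean n y' - P)\<^sup>2 \<le> 2 * V" using n0 by simp
  moreover have "2 * V \<le> 3 / 100 * z\<^sup>2"
    using n67 V mult_right_mono[of 67 n V] unfolding z by simp
  moreover have "sqrt (5 * (n * V)) \<le> 22361 / 10000 * z"
  proof -
    have "sqrt (5 * (n * V)) = sqrt 5 * z" unfolding z_def by (rule real_sqrt_mult)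
    also have "\<dots> \<le> 22361 / 10000 * z"
      using z by (intro mult_right_mono real_le_lsqrt) (auto simp: power2_eq_square)
    finally show ?thesis .
  qed
  \<comment> \<open>The parallel axis identity leaves \<open>n * (mean n y' - P)\<^sup>2\<close>,
    which is absorbed as \<open>3 / 100 * z\<^sup>2\<close>; hence the factor
    \<open>97 / 100\<close>.\<close>
  ultimately have zz: "97 / 100 * z\<^sup>2 - 22361 / 10000 * z \<le> scatter n y'"
    using ghost(2) unfolding z(2)[symmetric] by (simp add: algebra_simps)
  have "sqrt (scatter n y') \<le> sqrt (scatter n v') + sqrt n * (1 / n)"
    by (rule sqrt_scatter_le) (use near in auto)
  also have "sqrt (scatter n v') \<le> \<tau>" using \<tau> by (intro real_le_lsqrt) (auto simp: scatter_nonneg)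
  finally have "sqrt (scatter n y') \<le> \<tau> + 1 / 8" using rn by linarith
  then have "scatter n y' \<le> (\<tau> + 1 / 8)\<^sup>2" using sqrt_le_D by blast
  moreover have "z * (z - 2306 / 1000) = z\<^sup>2 - 2306 / 1000 * z" by (simp add: power2_eq_square algebra_simps)
  moreover have "0 \<le> (\<tau> + 1 / 8)\<^sup>2" by simp
  \<comment> \<open>Division by \<open>97 / 100\<close>, rounded up: \<open>2306 / 1000\<close> for
    the linear coefficient and \<open>1031 / 1000\<close> for the factor on the right, whose root is
    below \<open>10154 / 10000\<close>.\<close>
  ultimately have "z * (z - 2306 / 1000) \<le> 1031 / 1000 * (\<tau> + 1 / 8)\<^sup>2"
    using zz z(1) by linarith
  also have "\<dots> \<le> (10154 / 10000 * (\<tau> + 1 / 8))\<^sup>2"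
    unfolding power_mult_distrib by (intro mult_right_mono) (auto simp: power2_eq_square)
  finally have zb: "z \<le> 2306 / 1000 + 10154 / 10000 * (\<tau> + 1 / 8)"
    using \<tau>(1) by (intro quadratic_root_bound) auto
  define l where "l = sqrt L"
  have "1732 / 1000 \<le> l" unfolding l_def using L by (intro real_le_rsqrt) (auto simp: power2_eq_square)
  moreover have lL: "l * l = L" using L by (simp add: l_def)
  ultimately have l: "l \<ge> 1732 / 1000" "l * l = L" "l \<le> L"
    using mult_right_mono[of 1 l l] by auto
  define q where "q = sqrt (scatter n y)"
  have q: "q \<ge> 0" using scatter_nonneg by (simp add: q_def)
  have "sqrt (scatter n v) \<le> q + sqrt n * (1 / n)"
    unfolding q_def by (rule sqrt_scatter_le) (use near in \<open>auto simp: abs_minus_commute\<close>)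
  also have "\<dots> \<le> q + 1 / 8" using rn by (rule add_left_mono)
  finally have "14833 / 10000 * sqrt (scatter n v) \<le> 14833 / 10000 * (q + 1 / 8)"
    by (intro mult_left_mono) auto
  then have "\<tau> \<le> 15557 / 10000 * l + 14833 / 10000 * (q + 1 / 8)"
    using \<tau>(4) unfolding l_def by linarith
  then have lt: "l * \<tau> \<le> l * (15557 / 10000 * l + 14833 / 10000 * (q + 1 / 8))"
    using l by (intro mult_left_mono) auto
  have "1732 / 1000 * \<tau> \<le> l * \<tau>" using l \<tau> by (intro mult_right_mono) auto
  moreover have "mean n y' \<le> mean n v' + 1 / n" "mean n v \<le> mean n y + 1 / n"
    using near n0 by (auto intro!: mean_le_mean simp: abs_le_iff algebra_simps)
  then have "n * mean n y' \<le> n * mean n v' + 1" "n * mean n v \<le> n * mean n y + 1"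
    using n0 by (auto simp: field_simps)
  moreover have "n * (P - mean n y) = n * (P - mean n y') + (n * mean n y' - n * mean n v')
      + n * (mean n v' - mean n v) + (n * mean n v - n * mean n y)"
    by (simp add: algebra_simps)
  moreover have "141422 / 100000 * z \<le> 3441 / 1000 + 1436005 / 1000000 * \<tau>"
    using zb \<tau>(1) unfolding distrib_left by linarith
  \<comment> \<open>Two cover errors of 1 and the constant \<open>3441 / 1000\<close> make up
    \<open>545 / 100\<close>. The bare \<open>\<tau>\<close> is absorbed into
    \<open>l * \<tau>\<close> by \<open>l \<ge> 1732 / 1000\<close>, which raises the coefficient 2
    to \<open>28292 / 10000\<close>.\<close>
  ultimately have "n * (P - mean n y) \<le> 545 / 100 + 28292 / 10000 * (l * \<tau>)"
    using P1 \<tau>(1,3) unfolding l_def[symmetric] mult.assoc by linarith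
  also have "\<dots> \<le> 545 / 100 + 28292 / 10000 * (l * (15557 / 10000 * l + 14833 / 10000 * (q + 1 / 8)))"
    by (rule add_left_mono[OF mult_left_mono[OF lt]]) simp
  also have "l * (15557 / 10000 * l + 14833 / 10000 * (q + 1 / 8))
      = 15557 / 10000 * (l * l) + 14833 / 10000 * (l * q) + 14833 / 80000 * l"
    by (simp add: algebra_simps)
  \<comment> \<open>The terms free of \<open>q\<close> fit into \<open>12 * L\<close> because
    \<open>l \<le> L\<close> and \<open>L \<ge> 3\<close>. The coefficient of \<open>l * q\<close>
    is just below \<open>42 / 10\<close>.\<close>
  also have "545 / 100 + 28292 / 10000 * (15557 / 10000 * (l * l) + 14833 / 10000 * (l * q) + 14833 / 80000 * l)
      \<le> 12 * L + 42 / 10 * (l * q)"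
    unfolding l(2) distrib_left using l(3) L q l(1) mult_nonneg_nonneg[of l q] by linarith
  finally have "n * (P - mean n y) \<le> 12 * L + 42 / 10 * (l * q)" .
  then have "P - mean n y \<le> 12 * L / n + 42 / 10 * (l * q) / n"
    using n0 by (simp add: field_simps)
  moreover have "12 * L / n \<le> 12 * L / (real n - 1)"
    using L n67 by (intro divide_left_mono) auto
  \<comment> \<open>The square of \<open>42 / 10\<close> is 17.64, below the constant 18 of the
    penalty.\<close>
  moreover have "42 / 10 * (l * q) / n \<le> sqrt (18 * L * (scatter n y / (real n - 1)) / n)"
  proof (rule real_le_rsqrt)
    have "(l * q)\<^sup>2 = L * scatter n y"
      using L scatter_nonneg[of n y] by (simp add: power_mult_distrib l_def q_def)
    then have "(42 / 10 * (l * q) / n)\<^sup>2 = 1764 / 100 * (L * scatter n y) / (real n * real n)"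
      unfolding power_divide power_mult_distrib[of "42 / 10"] by (simp add: power2_eq_square)
    also have "\<dots> \<le> 18 * (L * scatter n y) / (real n * real n)"
      using L scatter_nonneg[of n y] by (intro divide_right_mono) auto
    also have "\<dots> \<le> 18 * (L * scatter n y) / ((real n - 1) * real n)"
      using L scatter_nonneg[of n y] n67 by (intro divide_left_mono mult_right_mono) auto
    finally show "(42 / 10 * (l * q) / n)\<^sup>2 \<le> 18 * L * (scatter n y / (real n - 1)) / n" by simp
  qed
  ultimately show ?thesis by linarith
qed

section \<open>Penalized mean of a fixed hypothesis\<close>

text \<open>The two Bernstein conclusions bound the mean and the scatter of \<open>y\<close>. The
  leading terms of mean and penalty carry \<open>sqrt 2\<close> and \<open>sqrt 18\<close>, which
  add up to \<open>sqrt 32\<close>.\<close>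

lemma penalized_mean_bound:
  fixes y :: "nat \<Rightarrow> real" and L t P V :: real
  assumes L: "L \<ge> 3" "22 * L \<le> real n - 1" and t: "0 \<le> t" "t \<le> L"
    and V: "0 \<le> V" "V \<le> 1"
    and dev: "(\<Sum>i<n. y i - P) \<le> sqrt (2 * n * V * t) + t"
    and var: "(\<Sum>i<n. (y i - P)\<^sup>2 - V) \<le> sqrt (2 * n * V * t) + t"
  shows "mean n y + sqrt (18 * L) * sqrt (scatter n y / (real n - 1) / n)
    \<le> P + sqrt (32 * V * L / n) + 10 * L / (real n - 1)"
proof -
  define N where "N = real n"
  define s where "s = sqrt V"
  define l where "l = sqrt L"
  have N67: "N \<ge> 67" using L by (simp add: N_def)
  have n0: "n > 0" using N67 by (cases n) (auto simp: N_def)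
  have s: "0 \<le> s" "s \<le> 1" "s\<^sup>2 = V" using V by (auto simp: s_def)
  have l: "0 \<le> l" "l\<^sup>2 = L" using L by (auto simp: l_def)
  have "1 \<le> l" unfolding l_def using L by (intro real_le_rsqrt) auto
  then have lL: "l \<le> L" using l mult_right_mono[of 1 l l] by (simp add: power2_eq_square)
  have tl: "sqrt t \<le> l" using t by (simp add: l_def)
  have sq: "sqrt (2 * n * V * t) = sqrt 2 * (sqrt N * s * sqrt t)"
    by (simp add: real_sqrt_mult N_def s_def)
  have "sqrt (2 * n * V * t) \<le> sqrt 2 * (sqrt N * s * l)"
    unfolding sq using tl s N67 by (intro mult_left_mono) auto
  then have "N * (mean n y - P) \<le> sqrt 2 * (sqrt N * s * l) + L"
    using dev t by (simp add: N_def sum_subtractf sum_eq_mean algebra_simps)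
  then have "mean n y - P \<le> (sqrt 2 * (sqrt N * s * l) + L) / N"
    using N67 by (simp add: pos_le_divide_eq mult.commute)
  also have "\<dots> = sqrt 2 * (sqrt N / N) * s * l + L / N" by (simp add: add_divide_distrib)
  also have "sqrt N / N = 1 / sqrt N" using N67 by (simp add: field_simps)
  also have "L / N \<le> L / (N - 1)" using L N67 by (intro divide_left_mono) auto
  finally have 1: "mean n y - P \<le> sqrt 2 * (1 / sqrt N) * s * l + L / (N - 1)" by simp

  have "scatter n y \<le> (\<Sum>i<n. (y i - P)\<^sup>2)" by (rule scatter_le_sum_square)
  also have "\<dots> \<le> N * V + sqrt (2 * n * V * t) + t"
    using var by (simp add: sum_subtractf N_def)
  \<comment> \<open>Weakening \<open>sqrt 2\<close> to 2 completes the square, so that the root of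
    the scatter splits into \<open>sqrt N * s\<close> and \<open>sqrt t\<close>.\<close>
  also have "\<dots> \<le> N * V + 2 * (sqrt N * s * sqrt t) + t"
    unfolding sq using s t N67 by (intro add_mono mult_right_mono real_le_lsqrt) auto
  also have "\<dots> = (sqrt N * s + sqrt t)\<^sup>2"
    using N67 s t by (simp add: power2_sum power_mult_distrib)
  finally have "sqrt (scatter n y) \<le> sqrt N * s + sqrt t"
    using s t N67 by (intro real_le_lsqrt scatter_nonneg) auto
  then have sc: "sqrt (scatter n y) \<le> sqrt N * s + l" using tl by linarith
  define c where "c = sqrt (N - 1)"
  have c: "c \<ge> 8" "c\<^sup>2 = N - 1"
    using N67 by (auto simp: c_def intro!: real_le_rsqrt)
  have cN: "c \<le> sqrt N" unfolding c_def by simp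
  have "sqrt (18 * L) * sqrt (scatter n y / (real n - 1) / n)
      = sqrt 18 * l * (sqrt (scatter n y) / (c * sqrt N))"
    by (simp add: real_sqrt_mult real_sqrt_divide l_def c_def N_def)
  also have "\<dots> \<le> sqrt 18 * l * ((sqrt N * s + l) / (c * sqrt N))"
    using l sc c N67 by (intro mult_left_mono divide_right_mono) auto
  also have "(sqrt N * s + l) / (c * sqrt N) = s * (1 / c) + l / (c * sqrt N)"
    using N67 by (simp add: add_divide_distrib)
  \<comment> \<open>Replacing \<open>1 / sqrt (N - 1)\<close> by \<open>1 / sqrt N\<close> costs at
    most \<open>1 / (N - 1)\<close>, since the two roots differ by at most 1; with
    \<open>s \<le> 1\<close> this error is of lower order.\<close>
  also have "sqrt 18 * l * (s * (1 / c) + l / (c * sqrt N))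
      \<le> sqrt 18 * l * (s * (1 / sqrt N) + 1 / (N - 1) + l / (N - 1))"
  proof -
    have c0: "c > 0" "sqrt N > 0" using c N67 by auto
    have "(sqrt N - c) * (sqrt N + c) = 1" using N67 c by (simp add: power2_eq_square algebra_simps)
    moreover have "sqrt N + c \<ge> 1" using c cN by linarith
    then have "(sqrt N - c) * 1 \<le> (sqrt N - c) * (sqrt N + c)" using cN by (intro mult_left_mono) auto
    ultimately have "sqrt N - c \<le> 1" by simp
    then have "(sqrt N - c) / (c * sqrt N) \<le> 1 / (c * sqrt N)"
      using c0 by (intro divide_right_mono) auto
    moreover have "1 / c - 1 / sqrt N = (sqrt N - c) / (c * sqrt N)" using c0 by (simp add: field_simps)
    moreover have cc: "c * c \<le> c * sqrt N" using c0 cN by (intro mult_left_mono) auto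
    then have "1 / (c * sqrt N) \<le> 1 / (N - 1)" "l / (c * sqrt N) \<le> l / (N - 1)"
      using c0 c l by (auto intro!: divide_left_mono simp: power2_eq_square simp flip: c(2))
    ultimately have *: "1 / c - 1 / sqrt N \<le> 1 / (N - 1)" "l / (c * sqrt N) \<le> l / (N - 1)" by simp_all
    have "s * (1 / c - 1 / sqrt N) \<le> 1 * (1 / (N - 1))"
      using s * c0 cN by (intro mult_mono) (auto simp: field_simps)
    then have "s * (1 / c) \<le> s * (1 / sqrt N) + 1 / (N - 1)" by (simp add: algebra_simps)
    then show ?thesis using * l by (intro mult_left_mono add_mono) auto
  qed
  also have "\<dots> = sqrt 18 * (1 / sqrt N) * s * l + (sqrt 18 * l + sqrt 18 * L) / (N - 1)"
    using l by (simp add: algebra_simps power2_eq_square add_divide_distrib)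
  finally have 2: "sqrt (18 * L) * sqrt (scatter n y / (real n - 1) / n)
      \<le> sqrt 18 * (1 / sqrt N) * s * l + (sqrt 18 * l + sqrt 18 * L) / (N - 1)" .
  \<comment> \<open>With \<open>sqrt 18 \<le> 9 / 2\<close> the penalty contributes
    \<open>9 * L\<close> and the mean another \<open>L\<close>.\<close>
  have "sqrt 18 * l + sqrt 18 * L \<le> sqrt 18 * (2 * L)"
    using lL by (simp flip: distrib_left)
  also have "\<dots> \<le> 9 / 2 * (2 * L)"
    using L by (intro mult_right_mono real_le_lsqrt) (auto simp: power2_eq_square)
  finally have "(sqrt 18 * l + sqrt 18 * L) / (N - 1) + L / (N - 1) \<le> 10 * L / (N - 1)"
    using N67 unfolding add_divide_distrib[symmetric] by (intro divide_right_mono) auto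
  moreover have "sqrt 18 = sqrt (9 * 2)" "sqrt 32 = sqrt (16 * 2)" by simp_all
  then have "sqrt 18 = 3 * sqrt 2" "sqrt 32 = 4 * sqrt 2" unfolding real_sqrt_mult by simp_all
  then have "sqrt (32 * V * L / n) = sqrt 2 * (1 / sqrt N) * s * l + sqrt 18 * (1 / sqrt N) * s * l"
    by (simp add: real_sqrt_mult real_sqrt_divide s_def l_def N_def)
  ultimately show ?thesis using 1 2 unfolding N_def[symmetric] by linarith
qed

subsection \<open>Covers and swaps of the double sample\<close>

text \<open>An infimum over an empty set would be infinite, and a nonempty set of extended naturals
  contains its infimum by well-ordering.\<close>

lemma covering_number_attained:
  assumes "covering_number e m A < \<infinity>"
  obtains C where "finite C" "C \<subseteq> A" "\<And>a. a \<in> A \<Longrightarrow> \<exists>c\<in>C. linf_norm m (\<lambda>i. a i - c i) < e"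
    "enat (card C) = covering_number e m A"
proof -
  let ?S = "{C. finite C \<and> C \<subseteq> A \<and> (\<forall>a\<in>A. \<exists>c\<in>C. linf_norm m (\<lambda>i. a i - c i) < e)}"
  let ?T = "(\<lambda>C. enat (card C)) ` ?S"
  have cov: "covering_number e m A = Inf ?T" by (simp add: covering_number_def)
  have "?T \<noteq> {}"
  proof
    assume "?T = {}"
    then show False using assms unfolding cov by (simp only: Inf_enat_def) simp
  qed
  then obtain k where "k \<in> ?T" by (meson ex_in_conv)
  then have "Inf ?T \<in> ?T" by (rule wellorder_InfI)
  then show thesis unfolding cov[symmetric] using that by auto
qed

lemma covering_number_ge_1:
  assumes "A \<noteq> {}"
  shows "1 \<le> covering_number e m A"
  unfolding covering_number_def
proof (rule INF_greatest)
  fix C assume C: "C \<in> {C. finite C \<and> C \<subseteq> A \<and> (\<forall>a\<in>A. \<exists>c\<in>C. linf_norm m (\<lambda>i. a i - c i) < e)}"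
  then have "C \<noteq> {}" "finite C" using assms by auto
  then have "card C \<ge> 1" by (simp add: Suc_leI card_gt_0_iff)
  then show "1 \<le> enat (card C)" by (simp add: one_enat_def)
qed

lemma abs_le_linf_norm: "i < m \<Longrightarrow> \<bar>v i\<bar> \<le> linf_norm m v"
  unfolding linf_norm_def by (intro Max_ge) auto

text \<open>A nonempty projection needs at least one center. This bound is what makes the logarithm
  \<open>L\<close> at least 3.\<close>

lemma capacity_ge_10:
  assumes X: "X \<noteq> {}" and F: "F \<noteq> {}" and n: "n > 0"
    and bd: "\<And>f x. f \<in> F \<Longrightarrow> x \<in> X \<Longrightarrow> f x \<in> {0..1}"
  shows "capacity X F n \<ge> 10"
proof -
  obtain x where x: "x \<in> {..<2 * n} \<rightarrow>\<^sub>E X"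
    using X by (metis PiE_eq_empty_iff ex_in_conv)
  let ?g = "growth_function (1 / real n) X F (2 * n)"
  have "1 \<le> covering_number (1 / real n) (2 * n) (projections F (2 * n) x)"
    using F by (intro covering_number_ge_1) (auto simp: projections_def)
  also have "\<dots> \<le> ?g"
    unfolding growth_function_def using x by (intro SUP_upper)
  finally have "1 \<le> ?g" .
  moreover have "?g < \<infinity>" using n bd by (intro growth_function_finite) auto
  ultimately obtain k where "?g = enat k" "k \<ge> 1" by (cases ?g) (auto simp: one_enat_def)
  then show ?thesis by (simp add: capacity_def)
qed

text \<open>Because centers are themselves projections of hypotheses, their coordinates lie in
  \<open>[0,1]\<close>, as \<open>balanced_sample_bounds\<close> requires.\<close>

lemma sample_cover:
  assumes n: "n > 0" and z: "z \<in> {..<2 * n} \<rightarrow>\<^sub>E X"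
    and bd: "\<And>f x. f \<in> F \<Longrightarrow> x \<in> X \<Longrightarrow> f x \<in> {0..1}"
  obtains C where "finite C" "10 * real (card C) \<le> capacity X F n"
    "\<And>c k. c \<in> C \<Longrightarrow> k < 2 * n \<Longrightarrow> c k \<in> {0..1}"
    "\<And>f. f \<in> F \<Longrightarrow> \<exists>c\<in>C. \<forall>k<2 * n. \<bar>f (z k) - c k\<bar> \<le> 1 / real n"
proof -
  let ?g = "growth_function (1 / real n) X F (2 * n)"
  let ?A = "projections F (2 * n) z"
  have le: "covering_number (1 / real n) (2 * n) ?A \<le> ?g"
    unfolding growth_function_def using z by (intro SUP_upper)
  have fin: "?g < \<infinity>" using n bd by (intro growth_function_finite) auto
  with le have "covering_number (1 / real n) (2 * n) ?A < \<infinity>" by (rule order.strict_trans1)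
  then obtain C where C: "finite C" "C \<subseteq> ?A"
      "\<And>a. a \<in> ?A \<Longrightarrow> \<exists>c\<in>C. linf_norm (2 * n) (\<lambda>i. a i - c i) < 1 / real n"
      "enat (card C) = covering_number (1 / real n) (2 * n) ?A"
    by (rule covering_number_attained) blast
  have "enat (card C) \<le> ?g" using le C(4) by simp
  then have card: "card C \<le> the_enat ?g" using fin by (cases ?g) auto
  show thesis
  proof (rule that)
    show "10 * real (card C) \<le> capacity X F n" using card by (simp add: capacity_def)
    show "c k \<in> {0..1}" if ck: "c \<in> C" "k < 2 * n" for c k
    proof -
      obtain f where f: "f \<in> F" "c = (\<lambda>i\<in>{..<2 * n}. f (z i))"
        using C(2) ck(1) by (auto simp: projections_def)
      then show ?thesis using bd[OF f(1), of "z k"] z ck(2) by (simp add: PiE_iff)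
    qed
    show "\<exists>c\<in>C. \<forall>k<2 * n. \<bar>f (z k) - c k\<bar> \<le> 1 / real n" if f: "f \<in> F" for f
    proof -
      let ?a = "\<lambda>i\<in>{..<2 * n}. f (z i)"
      have "?a \<in> ?A" using f by (auto simp: projections_def)
      then obtain c where c: "c \<in> C" "linf_norm (2 * n) (\<lambda>i. ?a i - c i) < 1 / real n"
        using C(3) by blast
      have "\<bar>f (z k) - c k\<bar> \<le> 1 / real n" if "k < 2 * n" for k
        using abs_le_linf_norm[OF that, of "\<lambda>i. ?a i - c i"] c(2) that by simp
      then show ?thesis using c(1) by blast
    qed
  qed (rule C(1))
qed

section \<open>Random swaps\<close>

text \<open>The ghost sample occupies the indices \<open>n\<close> to \<open>2 * n - 1\<close>, so
  exchanging the pairs selected by \<open>A\<close> is a reindexing of one product space.\<close>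

definition swap_index :: "nat \<Rightarrow> nat set \<Rightarrow> nat \<Rightarrow> nat" where
  "swap_index n A k =
     (if k < n then if k \<in> A then n + k else k else if k - n \<in> A then k - n else k)"

lemma swap_index_involution:
  "A \<subseteq> {..<n} \<Longrightarrow> swap_index n A (swap_index n A k) = k"
  by (auto simp: swap_index_def)

lemma swap_index_less: "A \<subseteq> {..<n} \<Longrightarrow> k < 2 * n \<Longrightarrow> swap_index n A k < 2 * n"
  by (auto simp: swap_index_def)

lemma distr_PiM_swap:
  assumes M: "prob_space M" and A: "A \<subseteq> {..<n}"
  shows "distr (PiM {..<2 * n} (\<lambda>_. M)) (PiM {..<2 * n} (\<lambda>_. M))
      (\<lambda>z. \<lambda>k\<in>{..<2 * n}. z (swap_index n A k)) = PiM {..<2 * n} (\<lambda>_. M)"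
  using M A
  by (intro distr_PiM_reindex[where M = "\<lambda>_. M"])
     (auto intro: swap_index_less inj_on_inverseI[where g = "swap_index n A"] swap_index_involution)

text \<open>Each fixed swap preserves the law, so the probability of \<open>B\<close> is the
  integral of the proportion of swaps that lead into \<open>B\<close>. Averaging over
  \<open>A\<close> replaces an additional probability space for the signs.\<close>

lemma swap_average_bound:
  fixes b :: real
  assumes M: "prob_space M" and B: "B \<in> sets (PiM {..<2 * n} (\<lambda>_. M))"
    and count: "\<And>z. z \<in> space (PiM {..<2 * n} (\<lambda>_. M)) \<Longrightarrow>
      real (card {A \<in> Pow {..<n}. (\<lambda>k\<in>{..<2 * n}. z (swap_index n A k)) \<in> B}) \<le> 2 ^ n * b"
  shows "measure (PiM {..<2 * n} (\<lambda>_. M)) B \<le> b"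
proof -
  let ?P = "PiM {..<2 * n} (\<lambda>_. M)"
  let ?\<sigma> = "\<lambda>A z. \<lambda>k\<in>{..<2 * n}. z (swap_index n A k)"
  interpret P: prob_space ?P by (intro prob_space_PiM M)
  have \<sigma>: "?\<sigma> A \<in> measurable ?P ?P" if "A \<subseteq> {..<n}" for A
    using swap_index_less[OF that]
    by (intro measurable_restrict measurable_component_singleton) auto
  have ind: "integrable ?P (\<lambda>z. indicator B (?\<sigma> A z) :: real)" if "A \<subseteq> {..<n}" for A
    using measurable_compose[OF \<sigma>[OF that], of "indicator B :: _ \<Rightarrow> real"] B
    by (intro P.integrable_const_bound[of _ 1]) (auto simp: indicator_def)
  have eq: "measure ?P B = (\<integral>z. indicator B (?\<sigma> A z) \<partial>?P)" if "A \<subseteq> {..<n}" for A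
  proof -
    have "measure ?P B = (\<integral>z. indicator B z \<partial>?P)" using B sets.sets_into_space[OF B] by (simp add: Int_absorb2)
    also have "\<dots> = (\<integral>z. indicator B z \<partial>distr ?P ?P (?\<sigma> A))"
      using distr_PiM_swap[OF M that] by simp
    also have "\<dots> = (\<integral>z. indicator B (?\<sigma> A z) \<partial>?P)"
      using B by (intro integral_distr \<sigma> that) auto
    finally show ?thesis .
  qed
  have "2 ^ n * measure ?P B = (\<Sum>A\<in>Pow {..<n}. measure ?P B)" by (simp add: card_Pow)
  also have "\<dots> = (\<Sum>A\<in>Pow {..<n}. \<integral>z. indicator B (?\<sigma> A z) \<partial>?P)"
    by (intro sum.cong eq) auto
  also have "\<dots> = (\<integral>z. (\<Sum>A\<in>Pow {..<n}. indicator B (?\<sigma> A z)) \<partial>?P)"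
    by (intro Bochner_Integration.integral_sum[symmetric] ind) auto
  also have "\<dots> \<le> (\<integral>z. 2 ^ n * b \<partial>?P)"
  proof (intro integral_mono Bochner_Integration.integrable_sum ind)
    fix z assume "z \<in> space ?P"
    have "(\<Sum>A\<in>Pow {..<n}. indicator B (?\<sigma> A z)) = (\<Sum>A\<in>Pow {..<n}. if ?\<sigma> A z \<in> B then 1 else 0 :: real)"
      by (intro sum.cong) (auto simp: indicator_def)
    also have "\<dots> = real (card {A \<in> Pow {..<n}. ?\<sigma> A z \<in> B})"
      by (subst sum.If_cases) (auto simp: Int_def)
    finally show "(\<Sum>A\<in>Pow {..<n}. indicator B (?\<sigma> A z)) \<le> 2 ^ n * b"
      using count[OF \<open>z \<in> space ?P\<close>] by simp
  qed auto
  also have "\<dots> = 2 ^ n * b" by (simp add: P.prob_space)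
  finally show ?thesis by simp
qed

subsection \<open>Symmetrization\<close>

lemma
  fixes f :: "'a \<Rightarrow> real"
  assumes M: "prob_space M" and f[measurable]: "f \<in> borel_measurable M"
    and bd: "\<And>x. x \<in> space M \<Longrightarrow> f x \<in> {0..1}"
  shows risk_bounds: "risk f M \<in> {0..1}"
    and centered_abs_le: "\<And>x. x \<in> space M \<Longrightarrow> \<bar>f x - risk f M\<bar> \<le> 1"
    and centered_integral: "(\<integral>x. f x - risk f M \<partial>M) = 0"
    and true_variance_eq: "true_variance f M = (\<integral>x. (f x - risk f M)\<^sup>2 \<partial>M)"
    and true_variance_bounds: "true_variance f M \<in> {0..1}"
proof -
  interpret prob_space M by fact
  have int: "integrable M f"
    by (rule integrable_const_bound[of _ 1]) (use bd in auto)
  have "(\<integral>x. f x \<partial>M) \<le> (\<integral>x. 1 \<partial>M)"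
    using int bd by (intro integral_mono) auto
  moreover have "(\<integral>x. f x \<partial>M) \<ge> 0" using bd by (intro integral_nonneg_AE AE_I2) auto
  ultimately show r: "risk f M \<in> {0..1}" by (simp add: risk_def prob_space)
  show a: "\<bar>f x - risk f M\<bar> \<le> 1" if "x \<in> space M" for x using bd[OF that] r by auto
  show "(\<integral>x. f x - risk f M \<partial>M) = 0" using int by (simp add: risk_def prob_space)
  show v: "true_variance f M = (\<integral>x. (f x - risk f M)\<^sup>2 \<partial>M)" by (simp add: true_variance_def risk_def)
  have "(\<integral>x. (f x - risk f M)\<^sup>2 \<partial>M) \<le> (\<integral>x. 1 \<partial>M)"
    using a by (intro integral_mono integrable_const_bound[of _ 1]) (auto simp: abs_square_le_1)
  then show "true_variance f M \<in> {0..1}" unfolding v by (simp add: prob_space)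
qed

text \<open>The squared deviation \<open>U\<close> takes values in \<open>[0,1]\<close>, hence
  \<open>U\<^sup>2 \<le> U\<close> and its variance is at most its mean, the variance of
  \<open>f\<close>. So the same variance proxy serves for \<open>f\<close> and for its squared
  deviation.\<close>

lemma
  fixes f :: "'a \<Rightarrow> real"
  assumes M: "prob_space M" and f[measurable]: "f \<in> borel_measurable M"
    and bd: "\<And>x. x \<in> space M \<Longrightarrow> f x \<in> {0..1}"
  defines "W \<equiv> \<lambda>x. (f x - risk f M)\<^sup>2 - true_variance f M"
  shows sqdev_abs_le: "\<And>x. x \<in> space M \<Longrightarrow> \<bar>W x\<bar> \<le> 1"
    and sqdev_integral: "(\<integral>x. W x \<partial>M) = 0"
    and sqdev_variance: "(\<integral>x. (W x)\<^sup>2 \<partial>M) \<le> true_variance f M"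
proof -
  interpret prob_space M by fact
  define V where "V = true_variance f M"
  define U where "U = (\<lambda>x. (f x - risk f M)\<^sup>2)"
  have V: "V = (\<integral>x. U x \<partial>M)" "V \<in> {0..1}"
    using true_variance_eq[OF M f bd] true_variance_bounds[OF M f bd] by (auto simp: V_def U_def)
  have [measurable]: "U \<in> borel_measurable M" by (simp add: U_def)
  have U: "U x \<in> {0..1}" if "x \<in> space M" for x
    using centered_abs_le[OF M f bd that] by (auto simp: U_def abs_square_le_1)
  have int: "integrable M U" by (rule integrable_const_bound[of _ 1]) (use U in auto)
  have int2: "integrable M (\<lambda>x. (U x)\<^sup>2)"
    by (rule integrable_const_bound[of _ 1]) (use U in \<open>auto simp: abs_square_le_1\<close>)
  have W: "W = (\<lambda>x. U x - V)" by (simp add: W_def U_def V_def)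
  show "\<bar>W x\<bar> \<le> 1" if "x \<in> space M" for x using U[OF that] V(2) by (auto simp: W)
  show "(\<integral>x. W x \<partial>M) = 0" using int by (simp add: W V(1) prob_space)
  have "(\<integral>x. (W x)\<^sup>2 \<partial>M) = (\<integral>x. (U x)\<^sup>2 - 2 * V * U x + V\<^sup>2 \<partial>M)"
    by (simp add: W power2_diff mult_ac algebra_simps)
  also have "\<dots> = (\<integral>x. (U x)\<^sup>2 \<partial>M) - 2 * V * V + V\<^sup>2"
    using int int2 by (simp add: V(1) prob_space)
  also have "\<dots> \<le> (\<integral>x. (U x)\<^sup>2 \<partial>M)" by (simp add: power2_eq_square)
  also have "\<dots> \<le> (\<integral>x. U x \<partial>M)"
    using int int2 U by (intro integral_mono) (auto simp: power2_eq_square mult_left_le)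
  finally show "(\<integral>x. (W x)\<^sup>2 \<partial>M) \<le> true_variance f M" using V by (simp add: V_def)
qed

text \<open>The squared sums of the centered values and of the centered squared deviations have
  means at most \<open>w\<close>. Markov's inequality with factors 2 and 5 leaves probability
  \<open>1 - 1 / 2 - 1 / 5 = 3 / 10\<close>.\<close>

lemma ghost_sample_prob:
  fixes f :: "'a \<Rightarrow> real"
  assumes M: "prob_space M" and f[measurable]: "f \<in> borel_measurable M"
    and bd: "\<And>x. x \<in> space M \<Longrightarrow> f x \<in> {0..1}" and J: "finite J"
  defines "w \<equiv> card J * true_variance f M"
  shows "measure (PiM J (\<lambda>_. M)) {x \<in> space (PiM J (\<lambda>_. M)).
      (\<Sum>j\<in>J. f (x j) - risk f M)\<^sup>2 \<le> 2 * w \<and>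
      w \<le> (\<Sum>j\<in>J. (f (x j) - risk f M)\<^sup>2) + sqrt (5 * w)} \<ge> 3 / 10"
    (is "measure ?P ?G \<ge> _")
proof -
  interpret P: prob_space ?P by (intro prob_space_PiM M)
  let ?V = "true_variance f M" and ?Y = "\<lambda>x. f x - risk f M"
  let ?W = "\<lambda>x. (f x - risk f M)\<^sup>2 - true_variance f M"
  note Y = PiM_integral_sum_square[OF M J, of ?Y, OF _ centered_abs_le[OF M f bd] centered_integral[OF M f bd]]
  note W = PiM_integral_sum_square[OF M J, of ?W, OF _ sqdev_abs_le[OF M f bd] sqdev_integral[OF M f bd]]
  let ?B1 = "{x \<in> space ?P. (\<Sum>j\<in>J. ?Y (x j))\<^sup>2 > 2 * w}"
  let ?B2 = "{x \<in> space ?P. (\<Sum>j\<in>J. ?W (x j))\<^sup>2 > 5 * w}"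
  have "measure ?P ?B1 \<le> 1 / 2"
    using Y by (intro Markov_ineq_multiple) (auto simp: w_def true_variance_eq[OF M f bd])
  moreover have "measure ?P ?B2 \<le> 1 / 5"
    using W sqdev_variance[OF M f bd] by (intro Markov_ineq_multiple) (auto simp: w_def intro!: mult_left_mono)
  moreover have "measure ?P (?B1 \<union> ?B2) \<le> measure ?P ?B1 + measure ?P ?B2"
    by (intro measure_subadditive) auto
  moreover have "measure ?P (space ?P) \<le> measure ?P (?G \<union> (?B1 \<union> ?B2))"
  proof (intro P.finite_measure_mono subsetI)
    fix x assume x: "x \<in> space ?P"
    have "x \<in> ?G" if "x \<notin> ?B1 \<union> ?B2"
    proof -
      have 1: "(\<Sum>j\<in>J. ?Y (x j))\<^sup>2 \<le> 2 * w" "(\<Sum>j\<in>J. ?W (x j))\<^sup>2 \<le> 5 * w"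
        using that x by auto
      have "(- (\<Sum>j\<in>J. ?W (x j)))\<^sup>2 \<le> 5 * w" using 1(2) by simp
      then have "- (\<Sum>j\<in>J. ?W (x j)) \<le> sqrt (5 * w)" by (rule real_le_rsqrt)
      then show ?thesis using x 1(1) by (simp add: sum_subtractf w_def)
    qed
    then show "x \<in> ?G \<union> (?B1 \<union> ?B2)" by blast
  qed measurable
  moreover have "measure ?P (?G \<union> (?B1 \<union> ?B2)) \<le> measure ?P ?G + measure ?P (?B1 \<union> ?B2)"
    by (intro measure_subadditive) auto
  ultimately show ?thesis by (simp add: P.prob_space)
qed

text \<open>A swap preserves the sum of each pair, hence the grand mean, and flips the sign of each
  paired difference. Each inequality in \<open>balanced\<close> is thus a bound on one Rademacher
  sum, with coefficients \<open>g\<close>, \<open>- g\<close> and \<open>q\<close>.\<close>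

lemma card_bad_swaps_le:
  fixes c :: "nat \<Rightarrow> real" and L :: real and n :: nat
  assumes L: "L > 0"
  shows "real (card {A \<in> Pow {..<n}.
      \<not> balanced n L (\<lambda>i. c (swap_index n A i)) (\<lambda>i. c (swap_index n A (n + i)))})
    \<le> 3 * (2 ^ n * exp (- L))"
    (is "real (card ?S) \<le> _")
proof -
  define v where "v A i = c (swap_index n A i)" for A i
  define v' where "v' A i = c (swap_index n A (n + i))" for A i
  define m where "m A = (mean n (v A) + mean n (v' A)) / 2" for A
  define \<mu> where "\<mu> = (\<Sum>i<n. c i + c (n + i)) / (2 * n)"
  define g where "g i = c (n + i) - c i" for i
  define q where "q i = (c (n + i) - \<mu>)\<^sup>2 - (c i - \<mu>)\<^sup>2" for i
  define E where "E h = {A \<in> Pow {..<n}. (\<Sum>i<n. if i \<in> A then - h i else h i) > sqrt (2 * L * (\<Sum>i<n. (h i)\<^sup>2))}"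
    for h :: "nat \<Rightarrow> real"
  have E: "real (card (E h)) \<le> 2 ^ n * exp (- L)" for h
    using card_sign_sum_exceeding[OF _ L, of "{..<n}" h] by (simp add: E_def)
  have v: "v A i = (if i \<in> A then c (n + i) else c i)" "v' A i = (if i \<in> A then c i else c (n + i))"
    if "i < n" for A i
    using that by (auto simp: v_def v'_def swap_index_def)
  have m: "m A = \<mu>" for A
  proof -
    have "mean n (v A) + mean n (v' A) = (\<Sum>i<n. v A i + v' A i) / n"
      by (simp add: mean_def sum.distrib add_divide_distrib)
    also have "(\<Sum>i<n. v A i + v' A i) = (\<Sum>i<n. c i + c (n + i))"
      using v by (intro sum.cong) auto
    finally show ?thesis by (simp add: m_def \<mu>_def)
  qed
  have sums: "(\<Sum>i<n. v' A i - v A i) = (\<Sum>i<n. if i \<in> A then - g i else g i)"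
    "(\<Sum>i<n. v A i - v' A i) = (\<Sum>i<n. if i \<in> A then - (- g i) else - g i)"
    "(\<Sum>i<n. (v' A i - m A)\<^sup>2 - (v A i - m A)\<^sup>2) = (\<Sum>i<n. if i \<in> A then - q i else q i)"
    "(\<Sum>i<n. (v' A i - v A i)\<^sup>2) = (\<Sum>i<n. (g i)\<^sup>2)"
    "(\<Sum>i<n. ((v' A i - m A)\<^sup>2 - (v A i - m A)\<^sup>2)\<^sup>2) = (\<Sum>i<n. (q i)\<^sup>2)" for A
    unfolding m by (intro sum.cong refl; simp add: v g_def q_def power2_commute)+
  have "?S = {A \<in> Pow {..<n}. \<not> balanced n L (v A) (v' A)}"
    by (simp add: v_def[abs_def] v'_def[abs_def])
  also have "\<dots> \<subseteq> E g \<union> E (\<lambda>i. - g i) \<union> E q"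
    unfolding balanced_def Let_def m_def[symmetric] sums E_def by auto
  finally have "?S \<subseteq> E g \<union> E (\<lambda>i. - g i) \<union> E q" .
  then have "card ?S \<le> card (E g \<union> E (\<lambda>i. - g i) \<union> E q)"
    by (intro card_mono) (auto simp: E_def)
  also have "\<dots> \<le> card (E g) + card (E (\<lambda>i. - g i)) + card (E q)"
    by (meson card_Un_le add_right_mono order_trans)
  finally have "real (card ?S) \<le> real (card (E g)) + real (card (E (\<lambda>i. - g i))) + real (card (E q))"
    by linarith
  then show ?thesis using E[of g] E[of "\<lambda>i. - g i"] E[of q] by linarith
qed

section \<open>Risk bound for a selected hypothesis\<close>

text \<open>Given the first sample, \<open>h x\<close> is a single function independent of the ghost
  sample, so \<open>3 / 10\<close> of the probability of \<open>E\<close> is at most that of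
  \<open>B\<close>. The latter is bounded by three tails for each of at most
  \<open>capacity / 10\<close> centers; the factor 10 in \<open>capacity\<close> makes the constants
  cancel.\<close>

lemma penalized_risk_bound_selection:
  fixes M :: "'a measure" and F :: "('a \<Rightarrow> real) set" and h :: "(nat \<Rightarrow> 'a) \<Rightarrow> 'a \<Rightarrow> real"
    and L :: real and n :: nat
  assumes M: "prob_space M"
    and F: "\<And>f. f \<in> F \<Longrightarrow> f \<in> borel_measurable M"
    and bd: "\<And>f x. f \<in> F \<Longrightarrow> x \<in> space M \<Longrightarrow> f x \<in> {0..1}"
    and L: "L \<ge> 3" "22 * L \<le> real n - 1"
    and hF: "\<And>x. x \<in> space (sample_law M n) \<Longrightarrow> h x \<in> F"
    and h: "(\<lambda>(x, y). h x y) \<in> borel_measurable (sample_law M n \<Otimes>\<^sub>M M)"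
  defines "E \<equiv> {x \<in> space (sample_law M n). \<not> risk (h x) M
      \<le> mean n (\<lambda>i. h x (x i)) + sqrt (18 * L * (scatter n (\<lambda>i. h x (x i)) / (real n - 1)) / n)
        + 12 * L / (real n - 1)}"
  shows "E \<in> sets (sample_law M n)"
    and "measure (sample_law M n) E \<le> capacity (space M) F n * exp (- L)"
proof -
  interpret M: prob_space M by fact
  interpret prod: product_sigma_finite "\<lambda>_. M" by unfold_locales
  let ?I = "{..<n}" and ?J = "{n..<2 * n}" and ?K = "{..<2 * n}"
  let ?PI = "PiM ?I (\<lambda>_. M)" and ?PJ = "PiM ?J (\<lambda>_. M)" and ?PK = "PiM ?K (\<lambda>_. M)"
  interpret PI: prob_space ?PI by (intro prob_space_PiM M)
  interpret PJ: prob_space ?PJ by (intro prob_space_PiM M)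
  interpret PK: prob_space ?PK by (intro prob_space_PiM M)
  have n: "n > 0" using L by (cases n) auto
  have L0: "L > 0" using L by simp
  define V where "V x = true_variance (h x) M" for x
  define R where "R x = risk (h x) M" for x
  have R[measurable]: "R \<in> borel_measurable ?PI"
    unfolding R_def risk_def using h by (rule M.borel_measurable_lebesgue_integral)
  have V[measurable]: "V \<in> borel_measurable ?PI"
  proof -
    have "(\<lambda>p. ((\<lambda>(x, y). h x y) p - R (fst p))\<^sup>2) \<in> borel_measurable (?PI \<Otimes>\<^sub>M M)"
      using h by measurable
    then have "(\<lambda>(x, y). (h x y - R x)\<^sup>2) \<in> borel_measurable (?PI \<Otimes>\<^sub>M M)"
      by (simp add: case_prod_beta)
    then have "(\<lambda>x. \<integral>y. (h x y - R x)\<^sup>2 \<partial>M) \<in> borel_measurable ?PI"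
      by (rule M.borel_measurable_lebesgue_integral)
    then show ?thesis by (simp add: V_def[abs_def] true_variance_def R_def risk_def)
  qed
  have hx: "(\<lambda>x. h x (x i)) \<in> borel_measurable ?PI" if "i < n" for i
  proof -
    have "(\<lambda>x. (x, x i)) \<in> measurable ?PI (?PI \<Otimes>\<^sub>M M)"
      using that by (intro measurable_Pair measurable_component_singleton) auto
    from measurable_compose[OF this h] show ?thesis by simp
  qed
  define \<mu> where "\<mu> x = mean n (\<lambda>i. h x (x i))" for x
  define \<nu> where "\<nu> x = scatter n (\<lambda>i. h x (x i))" for x
  have \<mu>: "\<mu> \<in> borel_measurable ?PI"
    unfolding \<mu>_def mean_def by (intro borel_measurable_divide borel_measurable_sum hx) auto
  have \<nu>: "\<nu> \<in> borel_measurable ?PI"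
    unfolding \<nu>_def scatter_def \<mu>_def[symmetric]
    by (intro borel_measurable_sum borel_measurable_power borel_measurable_diff \<mu> hx) auto
  define bad where "bad x \<longleftrightarrow> \<not> R x \<le> \<mu> x + sqrt (18 * L * (\<nu> x / (real n - 1)) / n)
      + 12 * L / (real n - 1)" for x
  have bad_meas: "Measurable.pred ?PI bad"
    unfolding bad_def pred_def
    by (intro sets.sets_Collect_neg borel_measurable_le borel_measurable_add borel_measurable_const
        borel_measurable_divide borel_measurable_times measurable_compose[OF _ borel_measurable_sqrt] \<mu> \<nu> R)
  have E: "E = {x \<in> space ?PI. bad x}" by (simp add: E_def bad_def R_def \<mu>_def \<nu>_def)
  show E_sets: "E \<in> sets ?PI" unfolding E using bad_meas by (simp add: pred_def)
  define lo where "lo z = (\<lambda>i\<in>?I. z i)" for z :: "nat \<Rightarrow> 'a"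
  have lo[measurable]: "lo \<in> measurable ?PK ?PI"
    unfolding lo_def by (intro measurable_restrict measurable_component_singleton) auto
  have hz: "(\<lambda>z. h (lo z) (z k)) \<in> borel_measurable ?PK" if "k < 2 * n" for k
  proof -
    have "(\<lambda>z. (lo z, z k)) \<in> measurable ?PK (?PI \<Otimes>\<^sub>M M)"
      using that by (intro measurable_Pair lo measurable_component_singleton) auto
    from measurable_compose[OF this h] show ?thesis by simp
  qed
  \<comment> \<open>Only coordinates of \<open>z'\<close> in \<open>?J\<close> enter, so the
    predicate applies both to a ghost sample and to a double sample.\<close>
  define ghost where "ghost x z' \<longleftrightarrow> (\<Sum>j\<in>?J. h x (z' j) - R x)\<^sup>2 \<le> 2 * (n * V x) \<and>
      n * V x \<le> (\<Sum>j\<in>?J. (h x (z' j) - R x)\<^sup>2) + sqrt (5 * (n * V x))" for x z'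
  define B where "B = {z \<in> space ?PK. bad (lo z) \<and> ghost (lo z) z}"
  have RV: "(\<lambda>z. R (lo z)) \<in> borel_measurable ?PK" "(\<lambda>z. V (lo z)) \<in> borel_measurable ?PK"
    by (rule measurable_compose[OF lo R], rule measurable_compose[OF lo V])
  have B[measurable]: "B \<in> sets ?PK"
  proof -
    have "Measurable.pred ?PK (\<lambda>z. bad (lo z))"
      using measurable_compose[OF lo bad_meas] by simp
    moreover have "Measurable.pred ?PK (\<lambda>z. ghost (lo z) z)"
      unfolding ghost_def pred_def
      by (intro sets.sets_Collect_conj borel_measurable_le borel_measurable_add borel_measurable_const
          borel_measurable_times borel_measurable_power borel_measurable_sum borel_measurable_diff
          measurable_compose[OF _ borel_measurable_sqrt] hz RV) auto
    ultimately show ?thesis unfolding B_def pred_def by (intro sets.sets_Collect_conj)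
  qed
  have spK: "z \<in> ?K \<rightarrow>\<^sub>E space M" if "z \<in> space ?PK" for z using that by (simp add: space_PiM)

  have "3 / 10 * measure ?PI E \<le> measure ?PK B"
  proof -
    have "ennreal (3 / 10 * measure ?PI E) = (\<integral>\<^sup>+x. ennreal (3 / 10) * indicator E x \<partial>?PI)"
      using E_sets
      by (subst ennreal_mult) (simp_all add: nn_integral_cmult_indicator PI.emeasure_eq_measure)
    also have "\<dots> \<le> (\<integral>\<^sup>+x. (\<integral>\<^sup>+z'. indicator B (merge ?I ?J (x, z')) \<partial>?PJ) \<partial>?PI)"
    proof (intro nn_integral_mono)
      fix x assume x: "x \<in> space ?PI"
      show "ennreal (3 / 10) * indicator E x \<le> (\<integral>\<^sup>+z'. indicator B (merge ?I ?J (x, z')) \<partial>?PJ)"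
      proof (cases "bad x")
        case False
        then show ?thesis unfolding E by simp
      next
        case True
        have hxF: "h x \<in> F" using x hF by simp
        let ?G = "{z' \<in> space ?PJ. ghost x z'}"
        have "3 / 10 \<le> measure ?PJ ?G"
          using ghost_sample_prob[OF M F[OF hxF] bd[OF hxF], of ?J]
          by (simp add: ghost_def R_def V_def)
        then have "ennreal (3 / 10) \<le> emeasure ?PJ ?G"
          by (simp add: PJ.emeasure_eq_measure)
        also have "emeasure ?PJ ?G = (\<integral>\<^sup>+z'. indicator ?G z' \<partial>?PJ)"
        proof -
          have "h x \<in> borel_measurable M" using F hxF by simp
          then have "?G \<in> sets ?PJ" unfolding ghost_def by measurable
          then show ?thesis by simp
        qed
        also have "\<dots> \<le> (\<integral>\<^sup>+z'. indicator B (merge ?I ?J (x, z')) \<partial>?PJ)"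
        proof (intro nn_integral_mono)
          fix z' assume z': "z' \<in> space ?PJ"
          let ?z = "merge ?I ?J (x, z')"
          have zK: "?z \<in> space ?PK"
            using x z' by (auto simp: space_PiM PiE_iff merge_def extensional_def)
          have lox: "lo ?z = x"
            using x by (auto simp: lo_def space_PiM PiE_iff merge_def extensional_def fun_eq_iff)
          have sum_eq: "(\<Sum>j\<in>?J. g (?z j)) = (\<Sum>j\<in>?J. g (z' j))" for g :: "'a \<Rightarrow> real"
            by (intro sum.cong) (auto simp: merge_def)
          have "ghost x ?z = ghost x z'"
            unfolding ghost_def using sum_eq[of "\<lambda>u. h x u - R x"] sum_eq[of "\<lambda>u. (h x u - R x)\<^sup>2"]
            by (simp only:)
          with zK lox show "indicator ?G z' \<le> (indicator B ?z :: ennreal)"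
            using True by (auto simp: indicator_def B_def)
        qed
        finally show ?thesis by (simp add: indicator_def)
      qed
    qed
    also have "\<dots> = (\<integral>\<^sup>+z. indicator B z \<partial>PiM (?I \<union> ?J) (\<lambda>_. M))"
    proof (rule prod.product_nn_integral_fold[symmetric])
      have "?I \<union> ?J = ?K" by auto
      then show "indicator B \<in> borel_measurable (PiM (?I \<union> ?J) (\<lambda>_. M))" by simp
    qed auto
    also have "?I \<union> ?J = ?K" by auto
    also have "(\<integral>\<^sup>+z. indicator B z \<partial>?PK) = ennreal (measure ?PK B)"
      by (simp add: PK.emeasure_eq_measure)
    finally show ?thesis by simp
  qed
  also have "measure ?PK B \<le> 3 / 10 * (capacity (space M) F n * exp (- L))"
  proof (rule swap_average_bound[OF M B])
    fix z assume z: "z \<in> space ?PK"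
    define \<sigma> where "\<sigma> A = (\<lambda>k\<in>?K. z (swap_index n A k))" for A
    \<comment> \<open>The cover is chosen for the unswapped \<open>z\<close> and serves all swaps,
      which only permute its coordinates. The selected hypothesis depends on \<open>A\<close>, yet
      always lies in \<open>F\<close> and so has a center in \<open>C\<close>.\<close>
    obtain C where C:
      "finite C" "10 * real (card C) \<le> capacity (space M) F n"
      "\<And>c k. c \<in> C \<Longrightarrow> k < 2 * n \<Longrightarrow> c k \<in> {0..1}"
      "\<And>f. f \<in> F \<Longrightarrow> \<exists>c\<in>C. \<forall>k<2 * n. \<bar>f (z k) - c k\<bar> \<le> 1 / real n"
      by (rule sample_cover[OF n spK[OF z], where F = F]) (rule bd, assumption+, blast)
    define S where "S c = {A \<in> Pow ?I.
      \<not> balanced n L (\<lambda>i. c (swap_index n A i)) (\<lambda>i. c (swap_index n A (n + i)))}" for c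
    have S: "real (card (S c)) \<le> 3 * (2 ^ n * exp (- L))" for c
      unfolding S_def by (rule card_bad_swaps_le[OF L0])
    \<comment> \<open>If a nearby center were balanced after the swap,
      \<open>ghost_sample_implies_bound\<close> would contradict \<open>bad\<close>.\<close>
    have "{A \<in> Pow ?I. \<sigma> A \<in> B} \<subseteq> (\<Union>c\<in>C. S c)"
    proof
      fix A assume "A \<in> {A \<in> Pow ?I. \<sigma> A \<in> B}"
      then have A: "A \<subseteq> ?I" and AB: "\<sigma> A \<in> B" by auto
      let ?x = "lo (\<sigma> A)"
      have sK: "\<sigma> A \<in> space ?PK" and bad: "bad ?x" and gh: "ghost ?x (\<sigma> A)"
        using AB by (auto simp: B_def)
      have x: "?x \<in> space ?PI" using measurable_space[OF lo sK] .
      have hxF: "h ?x \<in> F" using x hF by simp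
      then obtain c where c: "c \<in> C" "\<And>k. k < 2 * n \<Longrightarrow> \<bar>h ?x (z k) - c k\<bar> \<le> 1 / real n"
        using C(4) by blast
      have "A \<in> S c"
      proof (rule ccontr)
        assume nS: "A \<notin> S c"
        define y where "y i = h ?x (\<sigma> A i)" for i
        define y' where "y' i = h ?x (\<sigma> A (n + i))" for i
        have near: "\<bar>y i - c (swap_index n A i)\<bar> \<le> 1 / real n"
          "\<bar>y' i - c (swap_index n A (n + i))\<bar> \<le> 1 / real n" if "i < n" for i
          using c(2)[OF swap_index_less[OF A, of i]] c(2)[OF swap_index_less[OF A, of "n + i"]] that
          by (simp_all add: y_def y'_def \<sigma>_def)
        have shift: "(\<Sum>j\<in>?J. g j) = (\<Sum>i<n. g (n + i))" for g :: "nat \<Rightarrow> real"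
          by (rule sum.reindex_bij_witness[of _ "\<lambda>i. n + i" "\<lambda>j. j - n"]) auto
        have V0: "V ?x \<ge> 0"
          using true_variance_bounds[OF M F[OF hxF] bd[OF hxF]] by (simp add: V_def)
        have "R ?x \<le> mean n y + sqrt (18 * L * (scatter n y / (real n - 1)) / n) + 12 * L / (real n - 1)"
        proof (rule ghost_sample_implies_bound[OF L, where v = "\<lambda>i. c (swap_index n A i)"
              and v' = "\<lambda>i. c (swap_index n A (n + i))" and y' = y' and V = "V ?x"])
          show "c (swap_index n A i) \<in> {0..1}" "c (swap_index n A (n + i)) \<in> {0..1}" if "i < n" for i
            using that by (intro C(3)[OF c(1)] swap_index_less[OF A]; simp)+
        qed (use nS A near V0 gh in \<open>auto simp: S_def ghost_def shift y'_def\<close>)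
        moreover have "\<mu> ?x = mean n y" "\<nu> ?x = scatter n y"
          by (simp_all add: \<mu>_def \<nu>_def scatter_def mean_def y_def lo_def)
        ultimately show False using bad by (simp add: bad_def)
      qed
      then show "A \<in> (\<Union>c\<in>C. S c)" using c(1) by blast
    qed
    then have "card {A \<in> Pow ?I. \<sigma> A \<in> B} \<le> card (\<Union>c\<in>C. S c)"
      using C(1) by (intro card_mono finite_UN_I) (auto simp: S_def)
    also have "\<dots> \<le> (\<Sum>c\<in>C. card (S c))" using C(1) by (rule card_UN_le)
    finally have "real (card {A \<in> Pow ?I. \<sigma> A \<in> B}) \<le> (\<Sum>c\<in>C. real (card (S c)))"
      by (simp flip: of_nat_sum)
    also have "\<dots> \<le> (\<Sum>c\<in>C. 3 * (2 ^ n * exp (- L)))" by (intro sum_mono S)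
    also have "\<dots> = 3 / 10 * (10 * real (card C)) * (2 ^ n * exp (- L))" by simp
    also have "\<dots> \<le> 3 / 10 * capacity (space M) F n * (2 ^ n * exp (- L))"
      using C(2) by (intro mult_right_mono mult_left_mono) auto
    finally show "real (card {A \<in> Pow ?I. (\<lambda>k\<in>?K. z (swap_index n A k)) \<in> B})
        \<le> 2 ^ n * (3 / 10 * (capacity (space M) F n * exp (- L)))"
      by (simp add: \<sigma>_def mult_ac)
  qed
  finally show "measure ?PI E \<le> capacity (space M) F n * exp (- L)" by simp
qed

section \<open>Combination of the deviation bounds\<close>

theorem theorem15:
  fixes M :: "'a measure" and F :: "('a \<Rightarrow> real) set" and fstar :: "'a \<Rightarrow> real"
    and n :: nat and \<delta> :: real and SVP :: "(nat \<Rightarrow> 'a) \<Rightarrow> 'a \<Rightarrow> real"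
  defines "lam \<equiv> sqrt (18 * ln (3 * capacity (space M) F n / \<delta>))"
  assumes "prob_space M"
    and "\<And>f. f \<in> F \<Longrightarrow> f \<in> borel_measurable M"
    and "\<And>f x. f \<in> F \<Longrightarrow> x \<in> space M \<Longrightarrow> f x \<in> {0..1}"
    and "0 < \<delta>" and "\<delta> < 1"
    and "n \<ge> 2"
    and "fstar \<in> F"
    and "\<And>x. x \<in> space (sample_law M n) \<Longrightarrow> is_SVP F n lam x (SVP x)"
    and "(\<lambda>(x, y). SVP x y) \<in> borel_measurable (sample_law M n \<Otimes>\<^sub>M M)"
  shows "measure (sample_law M n) {x \<in> space (sample_law M n).
      risk (SVP x) M - risk fstar M
        \<le> sqrt (32 * true_variance fstar M * ln (3 * capacity (space M) F n / \<delta>) / real n)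
          + 22 * ln (3 * capacity (space M) F n / \<delta>) / (real n - 1)}
    \<ge> 1 - \<delta>"
proof -
  note M = assms(2) and F = assms(3) and bd = assms(4) and fF = assms(8) and SVP = assms(9)
    and SVP_meas = assms(10)
  interpret M: prob_space M by fact
  let ?P = "sample_law M n"
  interpret P: prob_space ?P by (intro prob_space_PiM M)
  define K where "K = capacity (space M) F n"
  define L where "L = ln (3 * K / \<delta>)"
  define t where "t = ln (3 / \<delta>)"
  define V where "V = true_variance fstar M"
  define R where "R = risk fstar M"
  have f[measurable]: "fstar \<in> borel_measurable M" using F fF by simp
  note fbd = bd[OF fF]
  have n: "real n \<ge> 2" using assms(7) by simp
  have K: "K \<ge> 10"
    unfolding K_def using M.not_empty fF assms(7) bd by (intro capacity_ge_10) auto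
  \<comment> \<open>\<open>K \<ge> 10\<close> and \<open>\<delta> < 1\<close> give
    \<open>3 * K / \<delta> \<ge> 30\<close>, while \<open>exp 1 \<le> 3\<close> bounds
    \<open>exp 3\<close> by 27; together \<open>L \<ge> 3\<close>.\<close>
  have "exp 3 \<le> (30 :: real)"
  proof -
    have "exp 3 = exp (1 :: real) ^ 3" by (simp flip: exp_of_nat_mult)
    also have "\<dots> \<le> 3 ^ 3" by (intro power_mono exp_le) auto
    finally show ?thesis by simp
  qed
  also have "30 \<le> 3 * K / \<delta>"
    using K assms(5,6) by (simp add: pos_le_divide_eq mult.commute[of _ \<delta>])
  finally have L3: "L \<ge> 3"
    unfolding L_def using K assms(5) by (subst ln_ge_iff) auto
  have eL: "K * exp (- L) = \<delta> / 3"
    unfolding L_def using K assms(5) by (simp add: exp_minus field_simps)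
  \<comment> \<open>Since \<open>fstar\<close> is fixed in advance, its deviation bounds need no
    union over a cover: the level \<open>t\<close> omits \<open>K\<close>, and each of the three
    events gets probability \<open>\<delta> / 3\<close>.\<close>
  have et: "exp (- t) = \<delta> / 3" unfolding t_def using assms(5) by (simp add: exp_minus)
  have t: "0 < t" "t \<le> L"
    unfolding t_def L_def using K assms(5,6) by (auto simp: divide_right_mono)
  have V: "0 \<le> V" "V \<le> 1" using true_variance_bounds[OF M f fbd] by (auto simp: V_def)
  have hF: "SVP x \<in> F" if "x \<in> space ?P" for x
    using SVP[OF that] by (simp add: is_SVP_def is_arg_min_def)
  let ?G = "{x \<in> space ?P. risk (SVP x) M - R \<le> sqrt (32 * V * L / n) + 22 * L / (real n - 1)}"
  have G: "?G \<in> sets ?P"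
  proof -
    have "(\<lambda>x. risk (SVP x) M) \<in> borel_measurable ?P"
      unfolding risk_def using SVP_meas by (rule M.borel_measurable_lebesgue_integral)
    then show ?thesis by measurable
  qed
  have "measure ?P ?G \<ge> 1 - \<delta>"
  proof (cases "22 * L \<le> real n - 1")
    \<comment> \<open>Here the last term of the bound already exceeds 1, the largest possible
      difference of two risks.\<close>
    case False
    have "x \<in> ?G" if x: "x \<in> space ?P" for x
    proof -
      have "risk (SVP x) M \<le> 1" "R \<ge> 0"
        using risk_bounds[OF M F[OF hF[OF x]] bd[OF hF[OF x]]] risk_bounds[OF M f fbd]
        by (auto simp: R_def)
      moreover have "1 \<le> 22 * L / (real n - 1)" using False n by (simp add: pos_le_divide_eq)
      moreover have "sqrt (32 * V * L / n) \<ge> 0" using V L3 by simp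
      ultimately have "risk (SVP x) M - R \<le> sqrt (32 * V * L / n) + 22 * L / (real n - 1)"
        by linarith
      then show ?thesis using x by simp
    qed
    then have "?G = space ?P" by auto
    then show ?thesis using assms(5) by (simp only: P.prob_space)
  next
    case True
    define E1 where "E1 = {x \<in> space ?P. \<not> risk (SVP x) M
      \<le> mean n (\<lambda>i. SVP x (x i)) + sqrt (18 * L * (scatter n (\<lambda>i. SVP x (x i)) / (real n - 1)) / n)
        + 12 * L / (real n - 1)}"
    define E2 where "E2 = {x \<in> space ?P. (\<Sum>i<n. fstar (x i) - R) \<ge> sqrt (2 * n * V * t) + t}"
    define E3 where "E3 = {x \<in> space ?P. (\<Sum>i<n. (fstar (x i) - R)\<^sup>2 - V) \<ge> sqrt (2 * n * V * t) + t}"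
    have E1: "E1 \<in> sets ?P" "measure ?P E1 \<le> K * exp (- L)"
      unfolding E1_def K_def
      by (rule penalized_risk_bound_selection[where F = F]; fact M F bd L3 True hF SVP_meas)+
    have "measure ?P E1 \<le> \<delta> / 3"
      using E1(2) eL by simp
    moreover have "measure ?P E2 \<le> \<delta> / 3"
      using Bernstein_ineq_PiM[OF M _ _ centered_abs_le[OF M f fbd] centered_integral[OF M f fbd] _ t(1),
          of "{..<n}" V] true_variance_eq[OF M f fbd]
      by (simp add: E2_def R_def V_def et)
    moreover have "measure ?P E3 \<le> \<delta> / 3"
      using Bernstein_ineq_PiM[OF M _ _ sqdev_abs_le[OF M f fbd] sqdev_integral[OF M f fbd]
          sqdev_variance[OF M f fbd] t(1), of "{..<n}"]
      by (simp add: E3_def R_def V_def et)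
    moreover have "1 \<le> measure ?P ?G + measure ?P E1 + measure ?P E2 + measure ?P E3"
    proof -
      have x_in: "x \<in> ?G" if x: "x \<in> space ?P" and nE: "x \<notin> E1" "x \<notin> E2" "x \<notin> E3" for x
      proof -
        have obj: "svp_objective n lam x g
            = mean n (\<lambda>i. g (x i)) + lam * sqrt (scatter n (\<lambda>i. g (x i)) / (real n - 1) / n)" for g
          by (simp add: svp_objective_def empirical_risk_eq sample_variance_eq)
        have lam: "lam = sqrt (18 * L)" by (simp add: lam_def L_def K_def)
        have "risk (SVP x) M \<le> svp_objective n lam x (SVP x) + 12 * L / (real n - 1)"
          using x nE(1) unfolding obj unfolding lam real_sqrt_mult[symmetric] E1_def by simp
        also have "svp_objective n lam x (SVP x) \<le> svp_objective n lam x fstar"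
          using SVP[OF x] fF by (auto simp: is_SVP_def is_arg_min_def not_less)
        also have "svp_objective n lam x fstar \<le> R + sqrt (32 * V * L / n) + 10 * L / (real n - 1)"
          unfolding obj unfolding lam
          by (rule penalized_mean_bound[OF L3 True less_imp_le[OF t(1)] t(2) V])
            (use x nE(2,3) in \<open>auto simp: E2_def E3_def\<close>)
        finally have "risk (SVP x) M \<le> R + sqrt (32 * V * L / n) + (10 * L / (real n - 1) + 12 * L / (real n - 1))"
          by simp
        also have "10 * L / (real n - 1) + 12 * L / (real n - 1) = 22 * L / (real n - 1)"
          by (simp flip: add_divide_distrib)
        finally show ?thesis using x by simp
      qed
      have E1s: "E1 \<in> sets ?P" using E1(1) by simp
      have E2s: "E2 \<in> sets ?P" unfolding E2_def by measurable
      have E3s: "E3 \<in> sets ?P" unfolding E3_def by measurable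
      have "1 = measure ?P (space ?P)" by (simp add: P.prob_space)
      also have "\<dots> \<le> measure ?P (?G \<union> (E1 \<union> (E2 \<union> E3)))"
      proof (rule P.finite_measure_mono)
        show "space ?P \<subseteq> ?G \<union> (E1 \<union> (E2 \<union> E3))" using x_in by blast
      qed (intro sets.Un G E1s E2s E3s)
      also have "\<dots> \<le> measure ?P ?G + measure ?P (E1 \<union> (E2 \<union> E3))"
        by (intro measure_Un_le sets.Un G E1s E2s E3s)
      also have "measure ?P (E1 \<union> (E2 \<union> E3)) \<le> measure ?P E1 + measure ?P (E2 \<union> E3)"
        by (intro measure_Un_le sets.Un E1s E2s E3s)
      also have "measure ?P (E2 \<union> E3) \<le> measure ?P E2 + measure ?P E3"
        by (intro measure_Un_le E2s E3s)
      finally show ?thesis by linarith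
    qed
    ultimately show ?thesis by linarith
  qed
  then show ?thesis by (simp only: L_def K_def V_def R_def)
qed

end
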